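(* Let $d$ be a fixed positive integer. (a) If $\varepsilon_{\mathbb{R}}$ is the best possible (maximum) efficiency for a lattice covering of $\mathbb{R}^d$ by $\bar S_1 = \{x\in\mathbb{R}^d : |x_1|+\dots+|x_d| \le 1\}$, then the size of the largest possible undirected Cayley graph of an Abelian group on $d$ generators with diameter at most $k$ is $(2^d \varepsilon_{\mathbb{R}}/d!)\,k^d + O(k^{d-1})$ as $k \to \infty$. (b) If $\varepsilon'_{\mathbb{R}}$ is the best possible (maximum) efficiency for a lattice covering of $\mathbb{R}^d$ by $\bar S'_1 = \{x\in\mathbb{R}^d : x_1,\dots,x_d \ge 0,\ x_1+\dots+x_d \le 1\}$, then the size of the largest possible directed Cayley graph of an Abelian group on $d$ generators with diameter at most $k$ is $(\varepsilon'_{\mathbb{R}}/d!)\,k^d + O(k^{d-1})$ as $k \to \infty$.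
   Context: A lattice in $\mathbb{R}^d$ is the set of all integer linear combinations of $d$ linearly independent vectors. A lattice covering of $\mathbb{R}^d$ by a set $S$ of finite positive volume is given by a lattice $L$ with $S + L = \mathbb{R}^d$; its efficiency is $|\det M|/\mathrm{vol}(S) \le 1$, where $M$ is the matrix whose rows are generating vectors of $L$. Given an Abelian group $G$ (written additively) generated by a list of elements $g_1,\dots,g_d$: the undirected Cayley graph of $G$ on these generators has vertex set $G$, with $x,y$ adjacent iff $y = x \pm g_i$ for some $i$; the directed Cayley graph has a directed edge from $x$ to $y$ iff $y = x + g_i$ for some $i$. The size is $|G|$. The diameter is the maximum (directed) path distance from any vertex to any other, i.e. the least $k$ such that every element of $G$ is a sum of at most $k$ terms from $\{\pm g_1,\dots,\pm g_d\}$ (undirected), respectively $\{g_1,\dots,g_d\}$ (directed). *)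

theory Defs
  imports
    "HOL-Analysis.Analysis"
    "HOL-Algebra.Generated_Groups"
    "HOL-Library.Extended_Nat"
    "HOL-Library.Landau_Symbols"
begin

section \<open>Lattice coverings\<close>

definition generates_lattice :: "real^'n^'n \<Rightarrow> bool" where
  "generates_lattice M \<longleftrightarrow> inj (\<lambda>i. row i M) \<and> independent (rows M)"

definition lattice_of :: "real^'n^'n \<Rightarrow> (real^'n) set" where
  "lattice_of M = {(\<Sum>i\<in>UNIV. of_int (c i) *\<^sub>R row i M) | c :: 'n \<Rightarrow> int. True}"

text \<open>The sum of two sets below is the elementwise (Minkowski) sum.\<close>

definition lattice_covering :: "(real^'n) set \<Rightarrow> real^'n^'n \<Rightarrow> bool" where
  "lattice_covering S M \<longleftrightarrow>
     S \<in> lmeasurable \<and> 0 < measure lebesgue S \<and>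
     generates_lattice M \<and> S + lattice_of M = UNIV"

definition covering_efficiency :: "(real^'n) set \<Rightarrow> real^'n^'n \<Rightarrow> real" where
  "covering_efficiency S M = \<bar>det M\<bar> / measure lebesgue S"

definition is_best_efficiency :: "(real^'n) set \<Rightarrow> real \<Rightarrow> bool" where
  "is_best_efficiency S \<epsilon> \<longleftrightarrow>
     (\<exists>M. lattice_covering S M \<and> covering_efficiency S M = \<epsilon>) \<and>
     (\<forall>M. lattice_covering S M \<longrightarrow> covering_efficiency S M \<le> \<epsilon>)"

definition cross_polytope :: "(real^'n) set" where
  "cross_polytope = {x. (\<Sum>i\<in>UNIV. \<bar>x $ i\<bar>) \<le> 1}"

definition corner_simplex :: "(real^'n) set" where
  "corner_simplex = {x. (\<forall>i. 0 \<le> x $ i) \<and> (\<Sum>i\<in>UNIV. x $ i) \<le> 1}"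


section \<open>Cayley graphs of Abelian groups\<close>

text \<open>
  A graph on a vertex set is given by its set of (directed) edges; an undirected graph by a
  symmetric edge set. Distances are infinite between vertices not joined by a path.
\<close>

definition path_distance :: "('a \<times> 'a) set \<Rightarrow> 'a \<Rightarrow> 'a \<Rightarrow> enat" where
  "path_distance E x y = (INF n\<in>{n. (x, y) \<in> E ^^ n}. enat n)"

definition graph_diameter :: "'a set \<Rightarrow> ('a \<times> 'a) set \<Rightarrow> enat" where
  "graph_diameter V E = (SUP (x, y)\<in>V \<times> V. path_distance E x y)"

text \<open>Groups are those of \<^theory>\<open>HOL-Algebra.Group\<close>, hence written multiplicatively.\<close>

definition undirected_cayley :: "('a, 'b) monoid_scheme \<Rightarrow> 'a list \<Rightarrow> ('a \<times> 'a) set" where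
  "undirected_cayley G gs =
     {(x, y). x \<in> carrier G \<and> y \<in> carrier G \<and>
        (\<exists>g\<in>set gs. y = x \<otimes>\<^bsub>G\<^esub> g \<or> y = x \<otimes>\<^bsub>G\<^esub> inv\<^bsub>G\<^esub> g)}"

definition directed_cayley :: "('a, 'b) monoid_scheme \<Rightarrow> 'a list \<Rightarrow> ('a \<times> 'a) set" where
  "directed_cayley G gs =
     {(x, y). x \<in> carrier G \<and> y \<in> carrier G \<and> (\<exists>g\<in>set gs. y = x \<otimes>\<^bsub>G\<^esub> g)}"

text \<open>The generators form a list: repetitions and the identity are allowed.\<close>

definition abelian_generated_by ::
    "nat \<Rightarrow> ('a, 'b) monoid_scheme \<Rightarrow> 'a list \<Rightarrow> bool" where
  "abelian_generated_by d G gs \<longleftrightarrow>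
     comm_group G \<and> length gs = d \<and> set gs \<subseteq> carrier G \<and> generate G (set gs) = carrier G"

text \<open>
  One cannot quantify over all carrier types inside a formula, so the sizes are collected from
  groups with elements in \<^typ>\<open>nat\<close>. Nothing is lost: a graph of finite diameter on finitely
  many generators is finite, so its group has an isomorphic copy there; see
  \<open>order_in_undirected_sizes\<close> and \<open>order_in_directed_sizes\<close> below.
\<close>

definition undirected_sizes :: "nat \<Rightarrow> nat \<Rightarrow> nat set" where
  "undirected_sizes d k =
     {order G | (G :: nat monoid) gs. abelian_generated_by d G gs \<and>
        graph_diameter (carrier G) (undirected_cayley G gs) \<le> enat k}"

definition directed_sizes :: "nat \<Rightarrow> nat \<Rightarrow> nat set" where
  "directed_sizes d k =
     {order G | (G :: nat monoid) gs. abelian_generated_by d G gs \<and>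
        graph_diameter (carrier G) (directed_cayley G gs) \<le> enat k}"

text \<open>
  Both maxima are over finite nonempty sets; see \<open>undirected_sizes_finite\<close>,
  \<open>undirected_sizes_nonempty\<close> and their directed counterparts.
\<close>

definition largest_undirected :: "nat \<Rightarrow> nat \<Rightarrow> nat" where
  "largest_undirected d k = Max (undirected_sizes d k)"

definition largest_directed :: "nat \<Rightarrow> nat \<Rightarrow> nat" where
  "largest_directed d k = Max (directed_sizes d k)"


section \<open>The maxima are well defined and independent of the carrier type\<close>

lemma path_distance_le_iff:
  "path_distance E x y \<le> enat k \<longleftrightarrow> (\<exists>n\<le>k. (x, y) \<in> E ^^ n)"
proof
  assume a: "path_distance E x y \<le> enat k"
  let ?N = "enat ` {n. (x, y) \<in> E ^^ n}"
  have "?N \<noteq> {}"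
  proof
    assume "?N = {}"
    then have "path_distance E x y = \<infinity>"
      unfolding path_distance_def by (simp add: Inf_enat_def)
    then show False using a by simp
  qed
  then obtain e where "e \<in> ?N" by blast
  then have "(LEAST e. e \<in> ?N) \<in> ?N" by (rule LeastI)
  then have "Inf ?N \<in> ?N"
    using \<open>?N \<noteq> {}\<close> by (simp only: Inf_enat_def if_False)
  then show "\<exists>n\<le>k. (x, y) \<in> E ^^ n"
    using a by (auto simp: path_distance_def)
next
  assume "\<exists>n\<le>k. (x, y) \<in> E ^^ n"
  then obtain n where n: "n \<le> k" "(x, y) \<in> E ^^ n" by blast
  then have "path_distance E x y \<le> enat n"
    unfolding path_distance_def by (intro INF_lower) auto
  then show "path_distance E x y \<le> enat k"
    using n(1) by (meson enat_ord_simps(1) order_trans)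
qed

lemma graph_diameter_le_iff:
  "graph_diameter V E \<le> enat k \<longleftrightarrow> (\<forall>x\<in>V. \<forall>y\<in>V. \<exists>n\<le>k. (x, y) \<in> E ^^ n)"
  by (auto simp: graph_diameter_def SUP_le_iff path_distance_le_iff)

lemma card_relpow_Image:
  fixes E :: "('a \<times> 'a) set"
  assumes "\<And>z. finite (E `` {z}) \<and> card (E `` {z}) \<le> D"
  shows "finite ((E ^^ n) `` {x}) \<and> card ((E ^^ n) `` {x}) \<le> D ^ n"
proof (induction n)
  case 0
  have "(E ^^ 0) `` {x} = {x}" by auto
  then show ?case by simp
next
  case (Suc n)
  let ?A = "(E ^^ n) `` {x}"
  have eq: "(E ^^ Suc n) `` {x} = (\<Union>z\<in>?A. E `` {z})"
    by auto
  have "card (\<Union>z\<in>?A. E `` {z}) \<le> (\<Sum>z\<in>?A. card (E `` {z}))"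
    using Suc by (intro card_UN_le) auto
  also have "\<dots> \<le> card ?A * D"
    using sum_bounded_above[of ?A "\<lambda>z. card (E `` {z})" D] assms by simp
  also have "\<dots> \<le> D ^ n * D"
    using Suc by simp
  finally show ?case
    unfolding eq using Suc assms by (auto simp: mult.commute)
qed

lemma graph_diameter_bound:
  assumes diam: "graph_diameter V E \<le> enat k"
    and deg: "\<And>z. finite (E `` {z}) \<and> card (E `` {z}) \<le> D"
  shows "finite V \<and> card V \<le> (\<Sum>n\<le>k. D ^ n)"
proof (cases "V = {}")
  case True
  then show ?thesis by simp
next
  case False
  then obtain x where x: "x \<in> V" by blast
  let ?B = "\<Union>n\<le>k. (E ^^ n) `` {x}"
  have sub: "V \<subseteq> ?B"
  proof
    fix y assume "y \<in> V"
    with diam x obtain n where "n \<le> k" "(x, y) \<in> E ^^ n"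
      unfolding graph_diameter_le_iff by blast
    then show "y \<in> ?B" by blast
  qed
  have fin: "finite ?B"
    using card_relpow_Image[of E D, OF deg] by auto
  have "card ?B \<le> (\<Sum>n\<le>k. card ((E ^^ n) `` {x}))"
    by (rule card_UN_le) simp
  also have "\<dots> \<le> (\<Sum>n\<le>k. D ^ n)"
    using card_relpow_Image[of E D, OF deg] by (intro sum_mono) auto
  finally show ?thesis
    using card_mono[OF fin sub] finite_subset[OF sub fin] by simp
qed

lemma undirected_cayley_degree:
  "finite (undirected_cayley G gs `` {z}) \<and>
   card (undirected_cayley G gs `` {z}) \<le> 2 * length gs"
proof -
  let ?A = "(\<lambda>g. z \<otimes>\<^bsub>G\<^esub> g) ` set gs" and ?B = "(\<lambda>g. z \<otimes>\<^bsub>G\<^esub> inv\<^bsub>G\<^esub> g) ` set gs"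
  have sub: "undirected_cayley G gs `` {z} \<subseteq> ?A \<union> ?B"
    by (auto simp: undirected_cayley_def)
  have "card ?A \<le> length gs" "card ?B \<le> length gs"
    by (meson card_image_le card_length finite_set order_trans)+
  then have "card (?A \<union> ?B) \<le> 2 * length gs"
    using card_Un_le[of ?A ?B] by simp
  then show ?thesis
    using card_mono[OF _ sub] finite_subset[OF sub] by (meson List.finite_set finite_UnI finite_imageI order_trans)
qed

lemma directed_subset_undirected: "directed_cayley G gs \<subseteq> undirected_cayley G gs"
  by (auto simp: directed_cayley_def undirected_cayley_def)

lemma directed_cayley_degree:
  "finite (directed_cayley G gs `` {z}) \<and>
   card (directed_cayley G gs `` {z}) \<le> 2 * length gs"
proof -
  have sub: "directed_cayley G gs `` {z} \<subseteq> undirected_cayley G gs `` {z}"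
    using directed_subset_undirected by blast
  show ?thesis
    using undirected_cayley_degree[of G gs z] card_mono[OF _ sub] finite_subset[OF sub]
    by (meson order_trans)
qed

lemma undirected_sizes_finite: "finite (undirected_sizes d k)"
proof (rule finite_subset)
  show "undirected_sizes d k \<subseteq> {..\<Sum>n\<le>k. (2 * d) ^ n}"
  proof
    fix m assume "m \<in> undirected_sizes d k"
    then obtain G :: "nat monoid" and gs where G: "m = order G" "length gs = d"
      and diam: "graph_diameter (carrier G) (undirected_cayley G gs) \<le> enat k"
      by (auto simp: undirected_sizes_def abelian_generated_by_def)
    show "m \<in> {..\<Sum>n\<le>k. (2 * d) ^ n}"
      using graph_diameter_bound[OF diam undirected_cayley_degree] G by (simp add: order_def)
  qed
qed simp

lemma directed_sizes_finite: "finite (directed_sizes d k)"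
proof (rule finite_subset)
  show "directed_sizes d k \<subseteq> {..\<Sum>n\<le>k. (2 * d) ^ n}"
  proof
    fix m assume "m \<in> directed_sizes d k"
    then obtain G :: "nat monoid" and gs where G: "m = order G" "length gs = d"
      and diam: "graph_diameter (carrier G) (directed_cayley G gs) \<le> enat k"
      by (auto simp: directed_sizes_def abelian_generated_by_def)
    show "m \<in> {..\<Sum>n\<le>k. (2 * d) ^ n}"
      using graph_diameter_bound[OF diam directed_cayley_degree] G by (simp add: order_def)
  qed
qed simp

lemma relpow_map_pair:
  fixes E :: "('a \<times> 'a) set" and E' :: "('b \<times> 'b) set"
  assumes "\<And>x y. (x, y) \<in> E \<Longrightarrow> (f x, f y) \<in> E'" and "(x, y) \<in> E ^^ n"
  shows "(f x, f y) \<in> E' ^^ n"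
  using assms(2)
proof (induction n arbitrary: y)
  case 0
  then show ?case by simp
next
  case (Suc n)
  then show ?case using assms(1) by auto
qed

lemma nat_copy:
  assumes gen: "abelian_generated_by d G gs" and fin: "finite (carrier G)"
  obtains H :: "nat monoid" and h where
    "abelian_generated_by d H (map h gs)" "order H = order G"
    "carrier H = h ` carrier G"
    "\<forall>x y. (x, y) \<in> undirected_cayley G gs \<longrightarrow> (h x, h y) \<in> undirected_cayley H (map h gs)"
    "\<forall>x y. (x, y) \<in> directed_cayley G gs \<longrightarrow> (h x, h y) \<in> directed_cayley H (map h gs)"
proof -
  interpret G: comm_group G
    using gen by (simp add: abelian_generated_by_def)
  obtain h :: "_ \<Rightarrow> nat" where h: "inj_on h (carrier G)"
    using fin finite_imp_inj_to_nat_seg by blast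
  define h' where "h' = the_inv_into (carrier G) h"
  have h': "h' (h x) = x" if "x \<in> carrier G" for x
    using that h by (simp add: h'_def the_inv_into_f_f)
  define H :: "nat monoid" where
    "H = \<lparr>carrier = h ` carrier G, mult = (\<lambda>a b. h (h' a \<otimes>\<^bsub>G\<^esub> h' b)), one = h \<one>\<^bsub>G\<^esub>\<rparr>"
  have H [simp]: "carrier H = h ` carrier G" "\<one>\<^bsub>H\<^esub> = h \<one>\<^bsub>G\<^esub>"
    by (simp_all add: H_def)
  have mult: "h x \<otimes>\<^bsub>H\<^esub> h y = h (x \<otimes>\<^bsub>G\<^esub> y)" if "x \<in> carrier G" "y \<in> carrier G" for x y
    using that by (simp add: H_def h')
  have "comm_group H"
  proof (rule comm_groupI)
    fix a assume "a \<in> carrier H"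
    then obtain x where x: "x \<in> carrier G" "a = h x" by auto
    then show "\<exists>b\<in>carrier H. b \<otimes>\<^bsub>H\<^esub> a = \<one>\<^bsub>H\<^esub>"
      by (intro bexI[of _ "h (inv\<^bsub>G\<^esub> x)"]) (auto simp: mult)
  qed (auto simp: mult G.m_ac)
  then interpret H: comm_group H .
  interpret group_hom G H h
    by unfold_locales (auto simp: hom_def mult)
  show ?thesis
  proof (rule that)
    have "generate H (h ` set gs) = h ` generate G (set gs)"
      using gen generate_img by (simp add: abelian_generated_by_def)
    then show "abelian_generated_by d H (map h gs)"
      using gen \<open>comm_group H\<close> by (auto simp: abelian_generated_by_def)
    show "order H = order G"
      using h by (simp add: order_def card_image)
    have gs: "set gs \<subseteq> carrier G"
      using gen by (simp add: abelian_generated_by_def)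
    show "\<forall>x y. (x, y) \<in> undirected_cayley G gs \<longrightarrow> (h x, h y) \<in> undirected_cayley H (map h gs)"
    proof (intro allI impI)
      fix x y
      assume "(x, y) \<in> undirected_cayley G gs"
      then obtain g where g: "x \<in> carrier G" "y \<in> carrier G" "g \<in> set gs"
        "y = x \<otimes>\<^bsub>G\<^esub> g \<or> y = x \<otimes>\<^bsub>G\<^esub> inv\<^bsub>G\<^esub> g"
        by (auto simp: undirected_cayley_def)
      moreover from g gs have "g \<in> carrier G" by blast
      ultimately have "h y = h x \<otimes>\<^bsub>H\<^esub> h g \<or> h y = h x \<otimes>\<^bsub>H\<^esub> inv\<^bsub>H\<^esub> (h g)"
        by (metis G.inv_closed hom_inv mult)
      moreover have "h x \<in> carrier H" "h y \<in> carrier H" "h g \<in> set (map h gs)"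
        using g by auto
      ultimately show "(h x, h y) \<in> undirected_cayley H (map h gs)"
        unfolding undirected_cayley_def by blast
    qed
    show "\<forall>x y. (x, y) \<in> directed_cayley G gs \<longrightarrow> (h x, h y) \<in> directed_cayley H (map h gs)"
    proof (intro allI impI)
      fix x y
      assume "(x, y) \<in> directed_cayley G gs"
      then obtain g where g: "x \<in> carrier G" "y \<in> carrier G" "g \<in> set gs" "y = x \<otimes>\<^bsub>G\<^esub> g"
        by (auto simp: directed_cayley_def)
      moreover from g gs have "g \<in> carrier G" by blast
      ultimately have "h y = h x \<otimes>\<^bsub>H\<^esub> h g"
        by (metis mult)
      moreover have "h x \<in> carrier H" "h y \<in> carrier H" "h g \<in> set (map h gs)"
        using g by auto
      ultimately show "(h x, h y) \<in> directed_cayley H (map h gs)"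
        unfolding directed_cayley_def by blast
    qed
  qed simp
qed

lemma graph_diameter_image:
  assumes "graph_diameter V E \<le> enat k"
    and "\<And>x y. (x, y) \<in> E \<Longrightarrow> (h x, h y) \<in> E'"
  shows "graph_diameter (h ` V) E' \<le> enat k"
  using assms(1) relpow_map_pair[of E h E', OF assms(2)]
  unfolding graph_diameter_le_iff by blast

theorem order_in_undirected_sizes:
  assumes gen: "abelian_generated_by d G gs"
    and diam: "graph_diameter (carrier G) (undirected_cayley G gs) \<le> enat k"
  shows "order G \<in> undirected_sizes d k"
proof -
  have "finite (carrier G)"
    using graph_diameter_bound[OF diam undirected_cayley_degree] by simp
  then obtain H :: "nat monoid" and h where
    *: "abelian_generated_by d H (map h gs)" "order H = order G"
    "carrier H = h ` carrier G"
    "\<forall>x y. (x, y) \<in> undirected_cayley G gs \<longrightarrow> (h x, h y) \<in> undirected_cayley H (map h gs)"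
    "\<forall>x y. (x, y) \<in> directed_cayley G gs \<longrightarrow> (h x, h y) \<in> directed_cayley H (map h gs)"
    by (rule nat_copy[OF gen])
  have "graph_diameter (carrier H) (undirected_cayley H (map h gs)) \<le> enat k"
    unfolding *(3) using diam by (rule graph_diameter_image) (use *(4) in blast)
  then show ?thesis
    using *(1,2) unfolding undirected_sizes_def mem_Collect_eq by metis
qed

theorem order_in_directed_sizes:
  assumes gen: "abelian_generated_by d G gs"
    and diam: "graph_diameter (carrier G) (directed_cayley G gs) \<le> enat k"
  shows "order G \<in> directed_sizes d k"
proof -
  have "finite (carrier G)"
    using graph_diameter_bound[OF diam directed_cayley_degree] by simp
  then obtain H :: "nat monoid" and h where
    *: "abelian_generated_by d H (map h gs)" "order H = order G"
    "carrier H = h ` carrier G"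
    "\<forall>x y. (x, y) \<in> undirected_cayley G gs \<longrightarrow> (h x, h y) \<in> undirected_cayley H (map h gs)"
    "\<forall>x y. (x, y) \<in> directed_cayley G gs \<longrightarrow> (h x, h y) \<in> directed_cayley H (map h gs)"
    by (rule nat_copy[OF gen])
  have "graph_diameter (carrier H) (directed_cayley H (map h gs)) \<le> enat k"
    unfolding *(3) using diam by (rule graph_diameter_image) (use *(5) in blast)
  then show ?thesis
    using *(1,2) unfolding directed_sizes_def mem_Collect_eq by metis
qed

lemma trivial_generated:
  obtains G :: "nat monoid" and gs where "abelian_generated_by d G gs" "carrier G = {0}"
proof
  define G :: "nat monoid" where "G = \<lparr>carrier = {0}, mult = (\<lambda>_ _. 0), one = 0\<rparr>"
  have "comm_group G"
    by (rule comm_groupI) (auto simp: G_def)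
  then interpret G: comm_group G .
  have "generate G (set (replicate d 0)) \<subseteq> carrier G"
    by (rule G.generate_incl) (auto simp: G_def)
  moreover have "\<one>\<^bsub>G\<^esub> \<in> generate G (set (replicate d 0))"
    by (rule generate.one)
  ultimately show "abelian_generated_by d G (replicate d 0)"
    using \<open>comm_group G\<close> by (auto simp: abelian_generated_by_def G_def)
  show "carrier G = {0}"
    by (simp add: G_def)
qed

lemma undirected_sizes_nonempty: "undirected_sizes d k \<noteq> {}"
proof -
  obtain G :: "nat monoid" and gs where G: "abelian_generated_by d G gs" "carrier G = {0}"
    by (rule trivial_generated)
  have "graph_diameter (carrier G) (undirected_cayley G gs) \<le> enat k"
    unfolding graph_diameter_le_iff G(2) by (auto intro: exI[of _ 0])
  then show ?thesis
    using order_in_undirected_sizes[OF G(1)] by blast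
qed

lemma directed_sizes_nonempty: "directed_sizes d k \<noteq> {}"
proof -
  obtain G :: "nat monoid" and gs where G: "abelian_generated_by d G gs" "carrier G = {0}"
    by (rule trivial_generated)
  have "graph_diameter (carrier G) (directed_cayley G gs) \<le> enat k"
    unfolding graph_diameter_le_iff G(2) by (auto intro: exI[of _ 0])
  then show ?thesis
    using order_in_directed_sizes[OF G(1)] by blast
qed

end

theory Submission
  imports Defs "HOL-Algebra.Multiplicative_Group"
begin

text \<open>
  A generator list of an Abelian group \<open>G\<close> is a homomorphism from \<open>\<int>\<^sup>d\<close> to \<open>G\<close>; if its
  kernel is \<open>L\<close>, the diameter is at most \<open>k\<close> iff the integer points of \<open>k S\<close> cover
  \<open>\<int>\<^sup>d\<close> modulo \<open>L\<close>, where \<open>S\<close> is the cross polytope or the corner simplex, and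
  \<open>|G|\<close> is the determinant of \<open>L\<close>.

  Upper bound: adding the unit cube, \<open>(k + d) S\<close> covers \<open>\<real>\<^sup>d\<close> modulo \<open>L\<close>, so \<open>L / (k + d)\<close>
  is a lattice covering by \<open>S\<close> and its efficiency is at most the best one.

  Lower bound: round the entries of \<open>k M\<close>, where \<open>M\<close> generates a best covering lattice. A point of
  \<open>k S\<close> has bounded coordinates with respect to \<open>k M\<close>, so the rounding moves it by \<open>O(1)\<close>, and the
  rounded lattice still covers with \<open>(k + c) S\<close>; its determinant is \<open>k\<^sup>d |det M| + O(k\<^sup>d\<^sup>-\<^sup>1)\<close>.
\<close>

section \<open>Volumes, packings and coverings\<close>

text \<open>
  The library proves the volume formula for linear images only for well-ordered index types.
\<close>

definition scales_measure :: "(real^'n \<Rightarrow> real^'n) \<Rightarrow> bool" where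
  "scales_measure f \<longleftrightarrow> (\<forall>S\<in>lmeasurable.
     f ` S \<in> lmeasurable \<and> measure lebesgue (f ` S) = \<bar>det (matrix f)\<bar> * measure lebesgue S)"

text \<open>\<open>measure_linear_sufficient\<close> passes a constant factor from boxes to all
  measurable sets; here the factor is 1.\<close>

lemma scales_measureI_cbox:
  fixes f :: "real^'n \<Rightarrow> real^'n"
  assumes "linear f" "\<bar>det (matrix f)\<bar> = 1"
    and "\<And>a b. cbox a b \<noteq> {} \<Longrightarrow> measure lebesgue (f ` cbox a b) = measure lebesgue (cbox a b)"
  shows "scales_measure f"
  unfolding scales_measure_def
proof
  fix S :: "(real^'n) set"
  assume S: "S \<in> lmeasurable"
  have "measure lebesgue (f ` cbox a b) = 1 * measure lebesgue (cbox a b)" for a b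
    using assms(3)[of a b] by (cases "cbox a b = {}") auto
  from measure_linear_sufficient[OF assms(1) S this] assms(2)
  show "f ` S \<in> lmeasurable \<and> measure lebesgue (f ` S) = \<bar>det (matrix f)\<bar> * measure lebesgue S"
    by simp
qed

text \<open>A swap of coordinates is an involution that carries a box to the box with permuted
  sides, so the product of side lengths is the same.\<close>

lemma scales_measure_transpose:
  "scales_measure (\<lambda>x::real^'n. \<chi> i. x $ Transposition.transpose m n i)" (is "scales_measure ?f")
proof (rule scales_measureI_cbox)
  show "linear ?f"
    by (rule linearI) (simp_all add: vec_eq_iff)
  have "matrix ?f = (\<chi> i. mat 1 $ Transposition.transpose m n i)"
    by (simp add: matrix_def mat_def axis_def vec_eq_iff)
  then show "\<bar>det (matrix ?f)\<bar> = 1"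
    by (simp add: det_permute_rows permutes_swap_id sign_swap_id)
next
  fix a b :: "real^'n"
  assume ne: "cbox a b \<noteq> {}"
  have "?f ` cbox a b = cbox (?f a) (?f b)"
  proof (intro equalityI subsetI)
    fix y assume y: "y \<in> cbox (?f a) (?f b)"
    have "?f y \<in> cbox a b"
      unfolding mem_box_cart
    proof
      fix i show "a $ i \<le> ?f y $ i \<and> ?f y $ i \<le> b $ i"
        using y[unfolded mem_box_cart, rule_format, of "Transposition.transpose m n i"] by simp
    qed
    moreover have "y = ?f (?f y)" by (simp add: vec_eq_iff)
    ultimately show "y \<in> ?f ` cbox a b" by blast
  qed (auto simp: mem_box_cart)
  moreover have "?f ` cbox a b \<noteq> {}" using ne by simp
  ultimately show "measure lebesgue (?f ` cbox a b) = measure lebesgue (cbox a b)"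
    using ne prod.permute[OF permutes_swap_id, of m UNIV n "\<lambda>i. b $ i - a $ i"]
    by (simp add: content_cbox_cart o_def)
qed

lemma scales_measure_shear:
  assumes "m \<noteq> n"
  shows "scales_measure (\<lambda>x::real^'n. \<chi> i. if i = m then x $ m + x $ n else x $ i)"
    (is "scales_measure ?f")
proof (rule scales_measureI_cbox)
  show lin: "linear ?f"
    by (rule linearI) (auto simp: vec_eq_iff algebra_simps)
  have "matrix ?f = (\<chi> k. if k = m then row m (mat 1) + 1 *s row n (mat 1) else row k (mat 1))"
    by (auto simp: matrix_def mat_def axis_def row_def vec_eq_iff)
  then show "\<bar>det (matrix ?f)\<bar> = 1"
    by (simp only: det_row_operation[OF assms]) simp
next
  fix a b :: "real^'n"
  assume ne: "cbox a b \<noteq> {}"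
  \<comment> \<open>Translating by \<open>v\<close> puts the lower bound of coordinate
    \<open>n\<close> at 0, which \<open>measure_shear_interval\<close> requires to be
    nonnegative.\<close>
  define v :: "real^'n" where "v = - (a $ n) *\<^sub>R axis n 1"
  have lin: "linear ?f"
    by (rule linearI) (auto simp: vec_eq_iff algebra_simps)
  have *: "?f (v + x) = ?f v + ?f x" for x
    using lin by (rule linear_add)
  have "measure lebesgue (?f ` cbox a b) = measure lebesgue ((+) (?f v) ` ?f ` cbox a b)"
    by (simp add: measure_translation)
  also have "(+) (?f v) ` ?f ` cbox a b = ?f ` cbox (v + a) (v + b)"
    unfolding cbox_translation image_image * ..
  also have "measure lebesgue \<dots> = measure lebesgue (cbox (v + a) (v + b))"
  proof (rule measure_shear_interval[OF assms])
    show "cbox (v + a) (v + b) \<noteq> {}"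
      using ne by (simp only: cbox_translation image_is_empty) simp
  qed (simp add: v_def)
  also have "\<dots> = measure lebesgue (cbox a b)"
    unfolding cbox_translation by (rule measure_translation)
  finally show "measure lebesgue (?f ` cbox a b) = measure lebesgue (cbox a b)" .
qed

text \<open>Every linear map is composed of swaps, shears, diagonal maps and maps that kill a
  coordinate. The last kind has determinant 0 and negligible images.\<close>

lemma linear_scales_measure:
  fixes f :: "real^'n \<Rightarrow> real^'n"
  assumes "linear f"
  shows "scales_measure f"
  using assms
proof (rule induct_linear_elementary)
  fix f g :: "real^'n \<Rightarrow> real^'n"
  assume "linear f" "linear g" "scales_measure f" "scales_measure g"
  then show "scales_measure (f \<circ> g)"
    unfolding scales_measure_def image_comp[symmetric]
    by (simp add: matrix_compose det_mul abs_mult)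
next
  fix f :: "real^'n \<Rightarrow> real^'n" and i
  assume f: "linear f" "\<And>x. f x $ i = 0"
  then have "\<not> inj f"
    by (metis linear_injective_imp_surjective surjD one_neq_zero vec_component)
  then have "negligible (f ` S)" "det (matrix f) = 0" for S
    using f(1) det_nz_iff_inj negligible_linear_singular_image by blast+
  then show "scales_measure f"
    by (simp add: scales_measure_def negligible_imp_measure0 negligible_imp_measurable)
next
  fix c :: "'n \<Rightarrow> real"
  have "det (matrix (\<lambda>x::real^'n. \<chi> i. c i * x $ i)) = prod c UNIV"
    by (subst det_diagonal) (auto simp: matrix_def axis_def)
  then show "scales_measure (\<lambda>x::real^'n. \<chi> i. c i * x $ i)"
    by (simp add: scales_measure_def measurable_stretch measure_stretch)
qed (rule scales_measure_transpose scales_measure_shear; assumption?)+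

lemma
  fixes f :: "real^'n \<Rightarrow> real^'n"
  assumes "linear f" "S \<in> lmeasurable"
  shows lmeasurable_linear_image: "f ` S \<in> lmeasurable"
    and measure_lebesgue_linear_image: "measure lebesgue (f ` S) = \<bar>det (matrix f)\<bar> * measure lebesgue S"
  using linear_scales_measure assms by (auto simp: scales_measure_def)

text \<open>The translates of \<open>D\<close> cut \<open>P\<close> into pieces \<open>A n\<close>.
  Moved back by \<open>l n\<close>, the pieces lie in \<open>D\<close>, and the packing condition
  makes them disjoint there.\<close>

lemma measure_packing_le_covering:
  fixes P D \<Lambda> :: "'a::euclidean_space set"
  assumes meas: "P \<in> lmeasurable" "D \<in> lmeasurable" and \<Lambda>: "countable \<Lambda>" "infinite \<Lambda>"
    and pack: "\<And>l l' p p'. \<lbrakk>l \<in> \<Lambda>; l' \<in> \<Lambda>; p \<in> P; p' \<in> P; p - l = p' - l'\<rbrakk> \<Longrightarrow> l = l'"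
    and cover: "D + \<Lambda> = UNIV"
  shows "measure lebesgue P \<le> measure lebesgue D"
proof -
  define l where "l = from_nat_into \<Lambda>"
  have l: "inj l" "range l = \<Lambda>"
    using bij_betw_from_nat_into[OF \<Lambda>] by (auto simp: l_def bij_betw_def)
  define A where "A n = P \<inter> (+) (l n) ` D" for n
  define B where "B n = (+) (- l n) ` A n" for n
  have A: "A n \<in> lmeasurable" for n
    unfolding A_def using meas by (intro fmeasurable.Int measurable_translation)
  then have B: "B n \<in> lmeasurable" for n
    unfolding B_def by (rule measurable_translation)
  have AB: "emeasure lebesgue (A n) = emeasure lebesgue (B n)" for n
    using A B measure_translation[of "- l n" "A n"]
    by (simp only: emeasure_eq_measure2 B_def)
  have "P \<subseteq> (\<Union>n. A n)"
  proof
    fix p assume p: "p \<in> P"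
    obtain d n where "d \<in> D" "p = d + l n"
      using cover l(2) by (metis UNIV_I rangeE set_plus_elim)
    with p show "p \<in> (\<Union>n. A n)" by (auto simp: A_def add.commute)
  qed
  then have "emeasure lebesgue P \<le> emeasure lebesgue (\<Union>n. A n)"
    using A by (intro emeasure_mono) (auto simp: fmeasurableD)
  also have "\<dots> \<le> (\<Sum>n. emeasure lebesgue (A n))"
    using A by (intro emeasure_subadditive_countably) (auto simp: fmeasurableD)
  also have "\<dots> = emeasure lebesgue (\<Union>n. B n)"
    unfolding AB
  proof (rule suminf_emeasure)
    show "disjoint_family B"
      unfolding disjoint_family_on_def
    proof (intro ballI impI)
      fix m n :: nat assume "m \<noteq> n"
      then have "l m \<noteq> l n" using l(1) by (auto dest: injD)
      then show "B m \<inter> B n = {}"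
        using pack[of "l m" "l n"] l(2) by (force simp: A_def B_def)
    qed
  qed (use B in \<open>auto simp: fmeasurableD\<close>)
  also have "\<dots> \<le> emeasure lebesgue D"
    using meas(2) by (intro emeasure_mono) (auto simp: A_def B_def fmeasurableD)
  finally show ?thesis
    using meas by (simp add: emeasure_eq_measure2)
qed

section \<open>Integer lattices\<close>

definition real_vec :: "int^'n \<Rightarrow> real^'n" where
  "real_vec z = (\<chi> i. of_int (z $ i))"

lemma real_vec_nth [simp]: "real_vec z $ i = of_int (z $ i)"
  by (simp add: real_vec_def)

lemma real_vec_add: "real_vec (x + y) = real_vec x + real_vec y"
  by (simp add: vec_eq_iff)

lemma real_vec_diff: "real_vec (x - y) = real_vec x - real_vec y"
  by (simp add: vec_eq_iff)

lemma real_vec_eq_iff [simp]: "real_vec x = real_vec y \<longleftrightarrow> x = y"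
  by (simp add: vec_eq_iff)

lemma lattice_of_eq: "lattice_of M = range (\<lambda>c. transpose M *v real_vec c)"
proof -
  have "(\<Sum>i\<in>UNIV. of_int (c i) *\<^sub>R row i M) = transpose M *v real_vec (\<chi> i. c i)" for c
    by (simp add: matrix_mult_sum scalar_mult_eq_scaleR)
  then have "lattice_of M = range (\<lambda>c. transpose M *v real_vec (\<chi> i. c i))"
    unfolding lattice_of_def by auto
  also have "\<dots> = range (\<lambda>c. transpose M *v real_vec c)"
  proof (intro equalityI subsetI)
    fix x assume "x \<in> range (\<lambda>c. transpose M *v real_vec c)"
    then obtain c where "x = transpose M *v real_vec (\<chi> i. c $ i)" by auto
    then show "x \<in> range (\<lambda>c. transpose M *v real_vec (\<chi> i. c i))" by blast
  qed auto
  finally show ?thesis .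
qed

lemma inj_transpose_mult:
  fixes M :: "real^'n^'n"
  assumes "det M \<noteq> 0"
  shows "inj ((*v) (transpose M))"
  using det_nz_iff_inj[of "(*v) (transpose M)"] assms by simp

lemma surj_transpose_mult:
  fixes M :: "real^'n^'n"
  assumes "det M \<noteq> 0"
  shows "surj ((*v) (transpose M))"
  using inj_transpose_mult[OF assms] by (rule linear_injective_imp_surjective[OF matrix_vector_mul_linear]) simp

lemma generates_lattice_iff: "generates_lattice M \<longleftrightarrow> det M \<noteq> 0" for M :: "real^'n^'n"
proof
  assume M: "generates_lattice M"
  have "inj ((*v) (transpose M))"
    unfolding linear_injective_0[OF matrix_vector_mul_linear]
  proof (intro allI impI)
    fix c assume "transpose M *v c = 0"
    then have sum_0: "(\<Sum>i\<in>UNIV. (c $ i) *\<^sub>R row i M) = 0"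
      by (simp add: matrix_mult_sum scalar_mult_eq_scaleR)
    \<comment> \<open>Independence speaks of the set of rows, so coefficients must be attached to
      row vectors instead of indices; injectivity of the rows makes this well defined.\<close>
    define c' where "c' r = c $ the_inv (\<lambda>i. row i M) r" for r
    have M': "inj (\<lambda>i. row i M)" "independent (rows M)" "rows M = range (\<lambda>i. row i M)"
      using M by (auto simp: generates_lattice_def rows_def)
    have c': "c' (row i M) = c $ i" for i
      using the_inv_f_f[OF M'(1), of i] by (simp add: c'_def)
    have "(\<Sum>r\<in>rows M. c' r *\<^sub>R r) = 0"
      using sum.reindex[OF M'(1), of "\<lambda>r. c' r *\<^sub>R r"] sum_0 by (simp add: M'(3) c')
    then have "\<forall>r\<in>rows M. c' r = 0"
      using M'(2) by (auto simp: independent_explicit)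
    then show "c = 0" by (simp add: vec_eq_iff M'(3) c')
  qed
  then show "det M \<noteq> 0"
    using det_nz_iff_inj[of "(*v) (transpose M)"] by simp
next
  assume M: "det M \<noteq> 0"
  then show "generates_lattice M"
    using det_identical_rows[of _ _ M] det_dependent_rows[of M]
    by (auto simp: generates_lattice_def inj_def dependent_vec_eq)
qed

lemma infinite_lattice_of:
  fixes M :: "real^'n^'n"
  assumes "det M \<noteq> 0"
  shows "infinite (lattice_of M)"
proof -
  have "inj (\<lambda>c. transpose M *v real_vec c)"
    using inj_transpose_mult[OF assms] unfolding inj_def by (metis real_vec_eq_iff)
  moreover have "infinite (UNIV :: (int^'n) set)"
  proof -
    have "inj (\<lambda>k::int. (\<chi> i. k) :: int^'n)" by (simp add: inj_def vec_eq_iff)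
    then show ?thesis using infinite_UNIV_int finite_imageD infinite_super top_greatest by metis
  qed
  ultimately show ?thesis
    unfolding lattice_of_eq by (simp add: finite_image_iff)
qed

lemma measure_unit_box:
  "measure lebesgue (box 0 (1 :: real^'n)) = 1" "measure lebesgue (cbox 0 (1 :: real^'n)) = 1"
proof -
  have *: "(1::real^'n) \<bullet> b = 1" if "b \<in> Basis" for b
    using that by (auto simp: Basis_vec_def inner_axis)
  show "measure lebesgue (box 0 (1 :: real^'n)) = 1"
    by (simp add: measure_lborel_box_eq *)
  show "measure lebesgue (cbox 0 (1 :: real^'n)) = 1"
    by (simp add: measure_lborel_cbox_eq *)
qed

text \<open>
  The cubes at coset representatives and the fundamental parallelepiped each pack (when open) and
  cover (when closed), so they have the same volume.
\<close>

lemma index_eq_abs_det: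
  fixes M :: "real^'n^'n" and \<phi> :: "int^'n \<Rightarrow> 'a"
  assumes M: "det M \<noteq> 0" and integral: "lattice_of M \<subseteq> range real_vec"
    and \<phi>: "\<And>x y. \<phi> x = \<phi> y \<longleftrightarrow> real_vec (x - y) \<in> lattice_of M"
    and fin: "finite (range \<phi>)"
  shows "real (card (range \<phi>)) = \<bar>det M\<bar>"
proof -
  \<comment> \<open>One integer vector from each coset of the lattice.\<close>
  define R where "R = inv_into UNIV \<phi> ` range \<phi>"
  have R: "finite R" "card R = card (range \<phi>)"
    using fin by (auto simp: R_def card_image inj_on_inv_into)
  have rep: "\<exists>a\<in>R. \<phi> a = \<phi> x" for x
    by (auto simp: R_def f_inv_into_f)
  have R_inj: "a = b" if "a \<in> R" "b \<in> R" "\<phi> a = \<phi> b" for a b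
    using that by (auto simp: R_def f_inv_into_f)
  define f where "f = (*v) (transpose M)"
  have f: "linear f" "inj f" "surj f" "det (matrix f) = det M"
    using inj_transpose_mult[OF M] surj_transpose_mult[OF M] by (simp_all add: f_def)
  have lat: "lattice_of M = range (\<lambda>c. f (real_vec c))"
    by (simp add: lattice_of_eq f_def)
  have count: "countable (lattice_of M)" "infinite (lattice_of M)"
    using M by (auto simp: infinite_lattice_of) (simp add: lattice_of_eq)
  have frac: "\<exists>c u. u \<in> cbox 0 1 \<and> x = u + real_vec c" for x :: "real^'n"
    by (intro exI[of _ "\<chi> i. \<lfloor>x $ i\<rfloor>"] exI[of _ "\<chi> i. frac (x $ i)"])
       (auto simp: mem_box_cart vec_eq_iff frac_def less_imp_le of_int_floor_le frac_lt_1
         intro: less_imp_le[OF frac_lt_1, unfolded frac_def])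
  have box_inj: "u = v \<and> c = d"
    if uv: "u \<in> box 0 1" "v \<in> box 0 1" and eq: "u + real_vec c = v + real_vec d"
    for u v :: "real^'n" and c d
  proof -
    have "c $ i = d $ i" for i
    proof -
      have "u $ i + of_int (c $ i) = v $ i + of_int (d $ i)"
        using arg_cong[OF eq, of "\<lambda>x. x $ i"] by simp
      moreover have "0 < u $ i" "u $ i < 1" "0 < v $ i" "v $ i < 1"
        using uv by (auto simp: mem_box_cart)
      ultimately show ?thesis by linarith
    qed
    then have "c = d" by (simp add: vec_eq_iff)
    with eq show ?thesis by simp
  qed
  have cube: "(+) (real_vec a) ` box 0 1 \<in> lmeasurable" "(+) (real_vec a) ` cbox 0 1 \<in> lmeasurable"
    "measure lebesgue ((+) (real_vec a) ` box 0 1) = 1"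
    "measure lebesgue ((+) (real_vec a) ` cbox 0 1) = 1" for a :: "int^'n"
    by (auto intro!: measurable_translation simp: measure_translation measure_unit_box
        simp del: measure_completion)
  let ?P = "\<Union>a\<in>R. (+) (real_vec a) ` box 0 1" and ?D = "\<Union>a\<in>R. (+) (real_vec a) ` cbox 0 1"
  have "measure lebesgue ?P \<le> measure lebesgue (f ` cbox 0 1)"
  proof (rule measure_packing_le_covering[OF _ _ count])
    show "?P \<in> lmeasurable"
      using R(1) cube by (intro fmeasurable.finite_UN) auto
    show "f ` cbox 0 1 \<in> lmeasurable"
      using f(1) by (intro lmeasurable_linear_image) auto
    have "x \<in> f ` cbox 0 1 + lattice_of M" for x
    proof -
      obtain y where "x = f y" using f(3) by blast
      moreover obtain c u where "u \<in> cbox 0 1" "y = u + real_vec c" using frac by blast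
      ultimately show ?thesis
        using linear_add[OF f(1)] by (auto simp: lat set_plus_def)
    qed
    then show "f ` cbox 0 1 + lattice_of M = UNIV" by blast
  next
    fix l l' p p'
    assume l: "l \<in> lattice_of M" "l' \<in> lattice_of M" and p: "p \<in> ?P" "p' \<in> ?P"
      and eq: "p - l = p' - l'"
    obtain c c' where c: "l = real_vec c" "l' = real_vec c'" using l integral by blast
    obtain a u where a: "a \<in> R" "u \<in> box 0 1" "p = real_vec a + u" using p(1) by auto
    obtain a' u' where a': "a' \<in> R" "u' \<in> box 0 1" "p' = real_vec a' + u'" using p(2) by auto
    have "u + real_vec (a - c) = u' + real_vec (a' - c')"
      using eq by (simp add: c a a' real_vec_diff algebra_simps)
    \<comment> \<open>Integer translates of the open cube are disjoint, so the integer parts agree.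
      Hence \<open>a - a'\<close> lies in the lattice, and both represent the same coset.\<close>
    then have ac: "a - c = a' - c'" using box_inj a(2) a'(2) by blast
    then have "real_vec (a - a') = l - l'"
      by (simp add: c flip: real_vec_diff) (simp add: algebra_simps)
    also obtain n n' where "l - l' = f (real_vec (n - n'))"
      using l by (auto simp: lat real_vec_diff linear_diff[OF f(1)])
    finally have "\<phi> a = \<phi> a'"
      unfolding \<phi> lat by blast
    then have "a = a'" using a(1) a'(1) R_inj by blast
    with ac show "l = l'" by (simp add: c)
  qed
  moreover have "measure lebesgue ?P = (\<Sum>a\<in>R. 1)"
  proof (subst measure_negligible_finite_Union_image)
    show "pairwise (\<lambda>a b. negligible ((+) (real_vec a) ` box 0 1 \<inter> (+) (real_vec b) ` box 0 1)) R"
    proof (rule pairwiseI)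
      fix a b :: "int^'n"
      assume "a \<noteq> b"
      then have "(+) (real_vec a) ` box 0 1 \<inter> (+) (real_vec b) ` box 0 1 = {}"
        using box_inj by (auto simp: add.commute)
      then show "negligible ((+) (real_vec a) ` box 0 1 \<inter> (+) (real_vec b) ` box 0 1)" by simp
    qed
  qed (use R(1) cube in \<open>auto simp del: measure_completion\<close>)
  \<comment> \<open>The reverse inequality exchanges the roles: the open parallelepiped packs and
    the closed cubes cover.\<close>
  moreover have "measure lebesgue (f ` box 0 1) \<le> measure lebesgue ?D"
  proof (rule measure_packing_le_covering[OF _ _ count])
    show "?D \<in> lmeasurable"
      using R(1) cube by (intro fmeasurable.finite_UN) auto
    show "f ` box 0 1 \<in> lmeasurable"
      using f(1) by (intro lmeasurable_linear_image) auto
    have "x \<in> ?D + lattice_of M" for x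
    proof -
      obtain c u where u: "u \<in> cbox 0 1" "x = u + real_vec c" using frac by blast
      obtain a where a: "a \<in> R" "\<phi> a = \<phi> c" using rep by blast
      then have "real_vec (c - a) \<in> lattice_of M" using \<phi> by metis
      moreover have "x = (real_vec a + u) + real_vec (c - a)"
        by (simp add: u real_vec_diff)
      ultimately show ?thesis using a(1) u(1) by (blast intro: set_plus_intro)
    qed
    then show "?D + lattice_of M = UNIV" by blast
  next
    fix l l' p p'
    assume l: "l \<in> lattice_of M" "l' \<in> lattice_of M" and p: "p \<in> f ` box 0 1" "p' \<in> f ` box 0 1"
      and eq: "p - l = p' - l'"
    obtain c c' where c: "l = f (real_vec c)" "l' = f (real_vec c')" using l lat by blast
    obtain u u' where u: "u \<in> box 0 1" "u' \<in> box 0 1" "p = f u" "p' = f u'" using p by blast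
    have "f (u + real_vec c') = f (u' + real_vec c)"
      using eq by (simp add: c u linear_add[OF f(1)] algebra_simps)
    then have "u + real_vec c' = u' + real_vec c" using f(2) by (auto dest: injD)
    then show "l = l'" using box_inj u(1,2) c by blast
  qed
  moreover have "measure lebesgue ?D \<le> (\<Sum>a\<in>R. 1)"
    using measure_UNION_le[OF R(1), of "\<lambda>a. (+) (real_vec a) ` cbox 0 1" lebesgue] cube
    by (auto simp: fmeasurableD simp del: measure_completion)
  moreover have "measure lebesgue (f ` box 0 1) = \<bar>det M\<bar>"
      "measure lebesgue (f ` cbox 0 1) = \<bar>det M\<bar>"
    by (simp_all add: measure_lebesgue_linear_image f measure_unit_box del: measure_completion)
  ultimately show ?thesis
    using R(2) by simp
qed

section \<open>Integer matrices and bases of integer lattices\<close>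

definition real_mat :: "int^'n^'n \<Rightarrow> real^'n^'n" where
  "real_mat A = (\<chi> i. real_vec (A $ i))"

lemma real_mat_nth [simp]: "real_mat A $ i = real_vec (A $ i)"
  by (simp add: real_mat_def)

lemma row_real_mat: "row i (real_mat A) = real_vec (A $ i)"
  by (simp add: row_def vec_eq_iff)

lemma det_real_mat: "det (real_mat A) = of_int (det A)"
  by (simp add: det_def)

lemma transpose_real_mat_mult:
  "transpose (real_mat A) *v real_vec c = real_vec (\<Sum>i\<in>UNIV. c $ i *s A $ i)"
  by (simp add: matrix_mult_sum row_real_mat vec_eq_iff)

text \<open>
  A basis is a tuple in \<open>L\<close> of least nonzero \<open>|det|\<close>: replacing one of its vectors by an element of
  \<open>L\<close> with a coordinate in the open unit interval would shrink the determinant.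
\<close>

lemma sublattice_basis:
  fixes L :: "(int^'n) set"
  assumes diff: "\<And>x y. x \<in> L \<Longrightarrow> y \<in> L \<Longrightarrow> x - y \<in> L" and N: "N \<noteq> 0" "\<And>i. axis i N \<in> L"
  obtains M :: "real^'n^'n" where "det M \<noteq> 0" "lattice_of M = real_vec ` L"
proof -
  have zero: "0 \<in> L" using diff[OF N(2)[of undefined] N(2)[of undefined]] by simp
  have uminus: "- x \<in> L" if "x \<in> L" for x using diff[OF zero that] by simp
  have add: "x + y \<in> L" if "x \<in> L" "y \<in> L" for x y using diff[OF that(1) uminus[OF that(2)]] by simp
  have nat_scale: "of_nat n *s x \<in> L" if "x \<in> L" for n x
  proof (induction n)
    case (Suc n)
    have "of_nat (Suc n) *s x = x + of_nat n *s x"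
      by (simp add: vec_eq_iff algebra_simps)
    then show ?case using Suc that add by simp
  qed (simp add: zero)
  have scale: "n *s x \<in> L" if "x \<in> L" for n x
  proof (cases n)
    case (neg m)
    have "(- c) *s x = - (c *s x)" for c
      by (simp add: vec_eq_iff)
    then show ?thesis using uminus[OF nat_scale[OF that]] neg by metis
  qed (use nat_scale[OF that] in simp)
  have comb: "(\<Sum>i\<in>I. g i *s x i) \<in> L" if "\<And>i. x i \<in> L" for I :: "'n set" and g x
    by (induction I rule: infinite_finite_induct) (auto simp: zero add scale that)
  let ?good = "\<lambda>A::int^'n^'n. (\<forall>i. A $ i \<in> L) \<and> det A \<noteq> 0"
  \<comment> \<open>The multiples \<open>N\<close> of the unit vectors show that a tuple of nonzero
    determinant exists.\<close>
  have "?good (\<chi> i. axis i N)"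
  proof -
    have "det ((\<chi> i. axis i N) :: int^'n^'n) = N ^ CARD('n)"
      by (subst det_diagonal) (auto simp: axis_def)
    then show ?thesis using N by simp
  qed
  then obtain A where A: "?good A" and least: "\<And>B. ?good B \<Longrightarrow> nat \<bar>det A\<bar> \<le> nat \<bar>det B\<bar>"
    using ex_has_least_nat[of ?good _ "\<lambda>A. nat \<bar>det A\<bar>"] by metis
  define M where "M = real_mat A"
  have M: "det M \<noteq> 0" using A by (simp add: M_def det_real_mat)
  have "real_vec z \<in> lattice_of M" if z: "z \<in> L" for z
  proof -
    obtain x where x: "real_vec z = transpose M *v x"
      using surj_transpose_mult[OF M] by blast
    \<comment> \<open>Removing the integer parts of the coordinates leaves an element
      \<open>w\<close> of \<open>L\<close> whose coordinates lie in \<open>[0, 1)\<close>.\<close>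
    define n :: "int^'n" where "n = (\<chi> i. \<lfloor>x $ i\<rfloor>)"
    define w where "w = z - (\<Sum>i\<in>UNIV. n $ i *s A $ i)"
    have w: "w \<in> L" unfolding w_def using z A by (intro diff comb) auto
    have w_eq: "real_vec w = transpose M *v (x - real_vec n)"
      by (simp only: w_def real_vec_diff x matrix_vector_mult_diff_distrib M_def transpose_real_mat_mult)
    have "x $ k = of_int (n $ k)" for k
    proof (rule ccontr)
      let ?t = "(x - real_vec n) $ k"
      assume "x $ k \<noteq> of_int (n $ k)"
      then have t: "0 < ?t" "?t < 1"
        unfolding n_def by (simp; linarith)+
      \<comment> \<open>By Cramer's rule, putting \<open>w\<close> in row \<open>k\<close>
        multiplies the determinant by \<open>?t\<close>, which lies strictly between 0 and 1; this
        contradicts minimality.\<close>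
      define B where "B = (\<chi> i. if i = k then w else A $ i)"
      have "real_mat B = (\<chi> i. if i = k then \<Sum>i\<in>UNIV. (x - real_vec n) $ i *s row i M else row i M)"
        using w_eq by (simp add: B_def vec_eq_iff matrix_mult_sum M_def row_def)
      then have "of_int (det B) = ?t * det M"
        by (simp only: det_real_mat[symmetric] cramer_lemma_transpose)
      then have dB: "of_int (det B) = ?t * of_int (det A)" by (simp add: M_def det_real_mat)
      then have "?good B"
        using A w t by (auto simp: B_def)
      then have "\<bar>det A\<bar> \<le> \<bar>det B\<bar>" using least by force
      then have "\<bar>real_of_int (det A)\<bar> \<le> ?t * \<bar>real_of_int (det A)\<bar>"
        using t(1) arg_cong[OF dB, of abs] by (simp add: abs_mult)
      moreover have "\<bar>real_of_int (det A)\<bar> > 0" using A by simp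
      ultimately show False using t(2) by (simp add: mult_le_cancel_right1)
    qed
    then have "x = real_vec n" by (simp add: vec_eq_iff)
    then show ?thesis using x by (auto simp: lattice_of_eq)
  qed
  moreover have "lattice_of M \<subseteq> real_vec ` L"
    unfolding lattice_of_eq M_def transpose_real_mat_mult using A comb by blast
  ultimately show ?thesis using that[OF M] by blast
qed

section \<open>Cayley graphs as quotients of integer lattices\<close>

text \<open>The flag \<open>D\<close>, here and below, selects the directed case.\<close>

definition gauge_ball :: "bool \<Rightarrow> real \<Rightarrow> (real^'n) set" where
  "gauge_ball D r = {x. (D \<longrightarrow> (\<forall>i. 0 \<le> x $ i)) \<and> (\<Sum>i\<in>UNIV. \<bar>x $ i\<bar>) \<le> r}"

lemma cross_polytope_eq: "cross_polytope = gauge_ball False 1"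
  by (simp add: cross_polytope_def gauge_ball_def)

lemma corner_simplex_eq: "corner_simplex = gauge_ball True 1"
  by (auto simp: corner_simplex_def gauge_ball_def)

lemma gauge_ball_scaleR:
  "c > 0 \<Longrightarrow> c *\<^sub>R x \<in> gauge_ball D (c * r) \<longleftrightarrow> x \<in> gauge_ball D r"
  by (simp add: gauge_ball_def abs_mult zero_le_mult_iff flip: sum_distrib_left)

lemma gauge_ball_add:
  assumes "x \<in> gauge_ball D r" "y \<in> gauge_ball D s"
  shows "x + y \<in> gauge_ball D (r + s)"
proof -
  have "(\<Sum>i\<in>UNIV. \<bar>(x + y) $ i\<bar>) \<le> (\<Sum>i\<in>UNIV. \<bar>x $ i\<bar>) + (\<Sum>i\<in>UNIV. \<bar>y $ i\<bar>)"
    unfolding sum.distrib[symmetric] by (intro sum_mono) (simp add: abs_triangle_ineq)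
  then show ?thesis using assms by (auto simp: gauge_ball_def)
qed

text \<open>Absorbs rounding errors into a larger radius. The errors are kept nonnegative so that
  the corner simplex is covered too.\<close>

lemma cube_subset_gauge_ball:
  fixes x :: "real^'n"
  assumes "\<And>i. 0 \<le> x $ i" "\<And>i. x $ i \<le> t"
  shows "x \<in> gauge_ball D (real CARD('n) * t)"
  using assms sum_bounded_above[of UNIV "\<lambda>i. \<bar>x $ i\<bar>" t] by (simp add: gauge_ball_def)

section \<open>The group of integer vectors\<close>

definition int_vec_group :: "(int^'n) monoid" where
  "int_vec_group = \<lparr>carrier = UNIV, monoid.mult = (+), one = 0\<rparr>"

lemma int_vec_group_simps [simp]:
  "carrier int_vec_group = UNIV" "x \<otimes>\<^bsub>int_vec_group\<^esub> y = x + y" "\<one>\<^bsub>int_vec_group\<^esub> = 0"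
  by (simp_all add: int_vec_group_def)

lemma comm_group_int_vec_group: "comm_group int_vec_group"
proof (rule comm_groupI)
  fix x :: "int^'n"
  show "\<exists>y\<in>carrier int_vec_group. y \<otimes>\<^bsub>int_vec_group\<^esub> x = \<one>\<^bsub>int_vec_group\<^esub>"
    by (intro bexI[of _ "- x"]) auto
qed auto

lemma inv_int_vec_group [simp]: "inv\<^bsub>int_vec_group\<^esub> x = - x"
  by (rule comm_group.axioms(2)[OF comm_group_int_vec_group, THEN group.inv_equality]) auto

section \<open>Paths in Cayley graphs as sums of unit steps\<close>

definition cayley :: "bool \<Rightarrow> ('a, 'b) monoid_scheme \<Rightarrow> 'a list \<Rightarrow> ('a \<times> 'a) set" where
  "cayley D = (if D then directed_cayley else undirected_cayley)"

definition unit_step :: "bool \<Rightarrow> int^'n \<Rightarrow> bool" where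
  "unit_step D u \<longleftrightarrow> (\<exists>i. u = axis i 1 \<or> (\<not> D \<and> u = - axis i 1))"

lemma unit_step_in_gauge_ball: "unit_step D u \<Longrightarrow> real_vec u \<in> gauge_ball D 1"
  by (auto simp: unit_step_def gauge_ball_def axis_def if_distrib[of abs] if_distrib[of real_of_int]
      if_distrib[of uminus] cong: if_cong)

text \<open>Moving a nonzero coordinate towards 0 by one lowers the sum of absolute values by
  exactly 1. In the directed case that coordinate is positive, so the step is a positive unit
  vector.\<close>

lemma gauge_ball_unit_step:
  fixes z :: "int^'n"
  assumes z: "real_vec z \<in> gauge_ball D (real (Suc n))" and "z \<noteq> 0"
  obtains u where "unit_step D u" "real_vec (z - u) \<in> gauge_ball D (real n)"
proof -
  obtain i where i: "z $ i \<noteq> 0" using \<open>z \<noteq> 0\<close> by (auto simp: vec_eq_iff)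
  define u where "u = (if z $ i > 0 then axis i 1 else - axis i 1 :: int^'n)"
  have u: "u $ j = (if j = i then sgn (z $ i) else 0)" for j
    using i by (auto simp: u_def axis_def)
  have "\<bar>real_of_int (z $ i) - sgn (z $ i)\<bar> = \<bar>real_of_int (z $ i)\<bar> - 1"
    using i by (auto simp: sgn_if)
  moreover have "(\<Sum>j\<in>UNIV. \<bar>real_vec (z - u) $ j\<bar>)
      = \<bar>real_of_int (z $ i) - sgn (z $ i)\<bar> + (\<Sum>j\<in>UNIV - {i}. \<bar>real_of_int (z $ j)\<bar>)"
    by (subst sum.remove[of UNIV i]) (auto simp: u intro!: sum.cong)
  moreover have "(\<Sum>j\<in>UNIV. \<bar>real_of_int (z $ j)\<bar>)
      = \<bar>real_of_int (z $ i)\<bar> + (\<Sum>j\<in>UNIV - {i}. \<bar>real_of_int (z $ j)\<bar>)"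
    by (subst sum.remove[of UNIV i]) auto
  moreover have "0 \<le> (z - u) $ j" if D for j
  proof -
    have "0 \<le> z $ i" "0 \<le> z $ j" using z that by (auto simp: gauge_ball_def)
    then show ?thesis using i by (auto simp: u sgn_if)
  qed
  ultimately have "real_vec (z - u) \<in> gauge_ball D (real n)"
    using z by (simp add: gauge_ball_def)
  moreover have "unit_step D u"
    using z i by (auto simp: u_def unit_step_def gauge_ball_def order.order_iff_strict)
  ultimately show ?thesis using that by blast
qed

text \<open>The map that sends a vector of multiplicities to the corresponding group element. Only
  \<open>set gs\<close> is prescribed, since the edges depend on nothing else.\<close>

locale int_vec_hom = comm_group G for G (structure) +
  fixes \<phi> :: "int^'n \<Rightarrow> 'a" and gs :: "'a list"
  assumes hom: "\<phi> \<in> hom int_vec_group G"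
    and gs: "set gs = range (\<lambda>i. \<phi> (axis i 1))"
begin

lemma closed [simp]: "\<phi> x \<in> carrier G"
  using hom by (auto simp: hom_def)

lemma add: "\<phi> (x + y) = \<phi> x \<otimes> \<phi> y"
  using hom by (auto simp: hom_def)

lemma group_hom: "group_hom int_vec_group G \<phi>"
  using comm_group.axioms(2)[OF comm_group_int_vec_group] hom
  by (intro group_hom.intro group_hom_axioms.intro) (simp_all add: is_group)

lemma zero: "\<phi> 0 = \<one>"
  using group_hom.hom_one[OF group_hom] by simp

lemma uminus: "\<phi> (- x) = inv \<phi> x"
  using group_hom.hom_inv[OF group_hom, of x] by simp

lemma eq_iff: "\<phi> x = \<phi> y \<longleftrightarrow> \<phi> (x - y) = \<one>"
proof -
  have *: "\<phi> x = \<phi> (x - y) \<otimes> \<phi> y" by (simp flip: add)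
  show ?thesis
    unfolding * by (rule r_cancel_one) (rule closed)+
qed

lemma cayley_iff:
  "(x, y) \<in> cayley D G gs \<longleftrightarrow> x \<in> carrier G \<and> (\<exists>u. unit_step D u \<and> y = x \<otimes> \<phi> u)"
proof -
  have "(\<exists>u. unit_step D u \<and> y = x \<otimes> \<phi> u) \<longleftrightarrow>
      (\<exists>i. y = x \<otimes> \<phi> (axis i 1) \<or> (\<not> D \<and> y = x \<otimes> inv \<phi> (axis i 1)))"
    unfolding unit_step_def by (auto simp flip: uminus)
  then show ?thesis
    by (auto simp: cayley_def directed_cayley_def undirected_cayley_def gs)
qed

lemma path_imp_sum:
  assumes "x \<in> carrier G" "(x, y) \<in> cayley D G gs ^^ n"
  shows "\<exists>z. real_vec z \<in> gauge_ball D (real n) \<and> y = x \<otimes> \<phi> z"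
  using assms(2)
proof (induction n arbitrary: y)
  case 0
  then show ?case
    using assms(1) by (intro exI[of _ 0]) (simp add: gauge_ball_def zero)
next
  case (Suc n)
  then obtain w z u where *: "real_vec z \<in> gauge_ball D (real n)" "w = x \<otimes> \<phi> z"
    "unit_step D u" "y = w \<otimes> \<phi> u"
    by (auto simp: cayley_iff) blast
  then have "y = x \<otimes> \<phi> (z + u)" by (simp add: add m_assoc assms(1))
  moreover have "real_vec (z + u) \<in> gauge_ball D (real (Suc n))"
    using gauge_ball_add[OF *(1) unit_step_in_gauge_ball[OF *(3)]]
    by (simp add: real_vec_add add.commute)
  ultimately show ?case by blast
qed

text \<open>Unit steps are split off \<open>z\<close> one at a time. The path may be shorter than
  \<open>n\<close> because it stops once \<open>z\<close> is 0.\<close>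

lemma sum_imp_path:
  assumes "x \<in> carrier G" "real_vec z \<in> gauge_ball D (real n)"
  shows "\<exists>m\<le>n. (x, x \<otimes> \<phi> z) \<in> cayley D G gs ^^ m"
  using assms
proof (induction n arbitrary: x z)
  case 0
  have "(\<Sum>i\<in>UNIV. \<bar>real_vec z $ i\<bar>) = 0"
    using 0(2) by (intro order_antisym sum_nonneg) (simp_all add: gauge_ball_def)
  then have "z = 0"
    by (subst (asm) sum_nonneg_eq_0_iff) (auto simp: vec_eq_iff)
  then show ?case using 0(1) by (simp add: zero)
next
  case (Suc n)
  show ?case
  proof (cases "z = 0")
    case True
    then show ?thesis using Suc.prems(1) by (intro exI[of _ 0]) (simp add: zero)
  next
    case False
    then obtain u where u: "unit_step D u" "real_vec (z - u) \<in> gauge_ball D (real n)"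
      using gauge_ball_unit_step[OF Suc.prems(2)] by blast
    define w where "w = x \<otimes> \<phi> u"
    have w: "(x, w) \<in> cayley D G gs" "w \<in> carrier G"
      using u(1) Suc.prems(1) by (auto simp: cayley_iff w_def)
    obtain m where m: "m \<le> n" "(w, w \<otimes> \<phi> (z - u)) \<in> cayley D G gs ^^ m"
      using Suc.IH[OF w(2) u(2)] by blast
    have "w \<otimes> \<phi> (z - u) = x \<otimes> \<phi> z"
      using Suc.prems(1) by (simp add: w_def m_assoc flip: add)
    with m w(1) have "(x, x \<otimes> \<phi> z) \<in> cayley D G gs ^^ Suc m"
      by (metis relpow_Suc_I2)
    with m(1) show ?thesis by (intro exI[of _ "Suc m"]) simp
  qed
qed

text \<open>Cayley graphs are homogeneous: a path from \<open>x\<close> to \<open>y\<close> amounts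
  to a representation of \<open>inv x \<otimes> y\<close>, so it suffices to represent every group
  element.\<close>

lemma diameter_le_iff:
  "graph_diameter (carrier G) (cayley D G gs) \<le> enat k \<longleftrightarrow>
   (\<forall>y\<in>carrier G. \<exists>z. real_vec z \<in> gauge_ball D (real k) \<and> y = \<phi> z)" (is "?l \<longleftrightarrow> ?r")
proof
  assume ?l
  show ?r
  proof
    fix y assume y: "y \<in> carrier G"
    then obtain n where n: "n \<le> k" "(\<one>, y) \<in> cayley D G gs ^^ n"
      using \<open>?l\<close> unfolding graph_diameter_le_iff by blast
    then obtain z where "real_vec z \<in> gauge_ball D (real n)" "y = \<phi> z"
      using path_imp_sum[OF one_closed n(2)] by auto
    with n(1) show "\<exists>z. real_vec z \<in> gauge_ball D (real k) \<and> y = \<phi> z"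
      by (intro exI[of _ z]) (auto simp: gauge_ball_def)
  qed
next
  assume r: ?r
  show ?l
    unfolding graph_diameter_le_iff
  proof (intro ballI)
    fix x y assume xy: "x \<in> carrier G" "y \<in> carrier G"
    then obtain z where z: "real_vec z \<in> gauge_ball D (real k)" "inv x \<otimes> y = \<phi> z"
      using r by (meson inv_closed m_closed)
    then have "x \<otimes> \<phi> z = y" using xy by (simp flip: z(2) add: m_assoc[symmetric])
    with sum_imp_path[OF xy(1) z(1)] show "\<exists>n\<le>k. (x, y) \<in> cayley D G gs ^^ n" by simp
  qed
qed

text \<open>A path from the identity never leaves the generated subgroup, and bounded diameter makes
  every element the end of such a path.\<close>

lemma generated:
  assumes "graph_diameter (carrier G) (cayley D G gs) \<le> enat k"
  shows "generate G (set gs) = carrier G"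
proof
  show "generate G (set gs) \<subseteq> carrier G"
    by (rule generate_incl) (auto simp: gs)
next
  have step: "y \<in> generate G (set gs)" if "x \<in> generate G (set gs)" "(x, y) \<in> cayley D G gs" for x y
    using that by (auto simp: cayley_def directed_cayley_def undirected_cayley_def
        intro: generate.eng generate.incl generate.inv split: if_splits)
  have path: "y \<in> generate G (set gs)" if "(\<one>, y) \<in> cayley D G gs ^^ n" for y n
    using that by (induction n arbitrary: y) (auto intro: generate.one step)
  then show "carrier G \<subseteq> generate G (set gs)"
    using assms unfolding graph_diameter_le_iff by blast
qed

end

section \<open>Attainable sizes\<close>

definition sizes :: "bool \<Rightarrow> nat \<Rightarrow> nat \<Rightarrow> nat set" where
  "sizes D = (if D then directed_sizes else undirected_sizes)"

lemma sizes_eq: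
  "sizes D d k = {order G | (G :: nat monoid) gs. abelian_generated_by d G gs \<and>
     graph_diameter (carrier G) (cayley D G gs) \<le> enat k}"
  by (simp add: sizes_def cayley_def directed_sizes_def undirected_sizes_def)

lemma order_in_sizes:
  assumes "abelian_generated_by d G gs" "graph_diameter (carrier G) (cayley D G gs) \<le> enat k"
  shows "order G \<in> sizes D d k"
  using assms order_in_directed_sizes order_in_undirected_sizes
  by (auto simp: sizes_def cayley_def split: if_splits)

lemma finite_sizes: "finite (sizes D d k)"
  by (simp add: sizes_def directed_sizes_finite undirected_sizes_finite)

lemma sizes_nonempty: "sizes D d k \<noteq> {}"
  by (simp add: sizes_def directed_sizes_nonempty undirected_sizes_nonempty)

lemma finite_of_diameter:
  assumes "graph_diameter (carrier G) (cayley D G gs) \<le> enat k"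
  shows "finite (carrier G)"
proof -
  have "finite (cayley D G gs `` {z}) \<and> card (cayley D G gs `` {z}) \<le> 2 * length gs" for z
    using directed_cayley_degree[of G gs z] undirected_cayley_degree[of G gs z]
    by (simp add: cayley_def)
  from graph_diameter_bound[OF assms this] show ?thesis by blast
qed

text \<open>The universal property of the free Abelian group, after numbering the coordinates. The
  formula on the axes later puts multiples of the unit vectors into the kernel.\<close>

lemma (in comm_group) ex_int_vec_hom:
  assumes "set gs \<subseteq> carrier G" "length gs = CARD('n::finite)"
  obtains \<phi> :: "int^'n \<Rightarrow> 'a" where "int_vec_hom G \<phi> gs" "\<And>i m. \<phi> (axis i m) = \<phi> (axis i 1) [^] m"
proof -
  obtain h :: "'n \<Rightarrow> nat" where h: "bij_betw h UNIV {..<CARD('n)}"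
    using ex_bij_betw_finite_nat[of "UNIV :: 'n set"] by (auto simp: atLeast0LessThan)
  define g where "g i = gs ! h i" for i
  have "range g = (!) gs ` {..<length gs}"
    using h assms(2) unfolding g_def bij_betw_def by (metis image_image)
  then have g: "range g = set gs"
    by (simp add: set_conv_nth image_def lessThan_def) blast
  then have gc [simp]: "g i \<in> carrier G" for i using assms(1) by blast
  define \<phi> where "\<phi> z = finprod G (\<lambda>i. g i [^] (z $ i)) UNIV" for z :: "int^'n"
  have axis: "\<phi> (axis i m) = g i [^] m" for i and m :: int
  proof -
    have "\<phi> (axis i m) = (\<Otimes>j\<in>UNIV. if i = j then g j [^] m else \<one>)"
      unfolding \<phi>_def by (rule finprod_cong') (auto simp: axis_def)
    also have "\<dots> = g i [^] m"
      by (rule finprod_singleton) auto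
    finally show ?thesis .
  qed
  have "\<phi> \<in> hom int_vec_group G"
    by (auto simp: hom_def \<phi>_def int_pow_mult intro!: finprod_closed)
  then have "int_vec_hom G \<phi> gs"
    by unfold_locales (simp_all add: axis g)
  then show ?thesis
    using that axis by simp
qed

section \<open>The upper bound\<close>

lemma det_scaleR:
  fixes M :: "real^'n^'n"
  shows "det (c *\<^sub>R M) = c ^ CARD('n) * det M"
proof -
  have "c *\<^sub>R M = (\<chi> i. c *s (M $ i))" by (simp add: vec_eq_iff)
  then show ?thesis using det_rows_mul[of "\<lambda>_. c" "\<lambda>i. M $ i"] by simp
qed

lemma size_upper_bound:
  assumes best: "is_best_efficiency (gauge_ball D 1 :: (real^'n) set) \<epsilon>"
    and m: "m \<in> sizes D CARD('n) k"
  shows "real m \<le> \<epsilon> * measure lebesgue (gauge_ball D 1 :: (real^'n) set) * (real k + real CARD('n)) ^ CARD('n)"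
proof -
  obtain G :: "nat monoid" and gs where G: "m = order G" "abelian_generated_by CARD('n) G gs"
    and diam: "graph_diameter (carrier G) (cayley D G gs) \<le> enat k"
    using m by (auto simp: sizes_eq)
  then interpret G: comm_group G by (simp add: abelian_generated_by_def)
  obtain \<phi> :: "int^'n \<Rightarrow> nat" where "int_vec_hom G \<phi> gs"
    and axis: "\<And>i m. \<phi> (axis i m) = \<phi> (axis i 1) [^]\<^bsub>G\<^esub> m"
    using G.ex_int_vec_hom G(2) by (metis abelian_generated_by_def)
  then interpret int_vec_hom G \<phi> gs by simp
  have fin: "finite (carrier G)" using diam by (rule finite_of_diameter)
  have range: "range \<phi> = carrier G"
    using diam unfolding diameter_le_iff by auto
  define L where "L = {z. \<phi> z = \<one>\<^bsub>G\<^esub>}"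
  obtain M :: "real^'n^'n" where M: "det M \<noteq> 0" "lattice_of M = real_vec ` L"
  proof (rule sublattice_basis[of L "int (order G)"])
    show "x - y \<in> L" if "x \<in> L" "y \<in> L" for x y
      using that eq_iff[of x y] by (simp add: L_def)
    show "int (order G) \<noteq> 0" using fin G.order_gt_0_iff_finite by simp
    \<comment> \<open>The order of the group annihilates every element, so the kernel has full
      rank.\<close>
    show "axis i (int (order G)) \<in> L" for i
      unfolding L_def mem_Collect_eq by (subst axis) (simp add: int_pow_int G.pow_order_eq_1)
  qed
  have card: "real m = \<bar>det M\<bar>"
  proof -
    have "real (card (range \<phi>)) = \<bar>det M\<bar>"
    proof (rule index_eq_abs_det[OF M(1)])
      show "\<phi> x = \<phi> y \<longleftrightarrow> real_vec (x - y) \<in> lattice_of M" for x y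
        unfolding M(2) eq_iff[of x y] by (auto simp: L_def)
    qed (use M(2) fin range in auto)
    then show ?thesis by (simp add: range G(1) order_def)
  qed
  \<comment> \<open>\<open>k\<close> is the radius for an integer point, and \<open>CARD('n)\<close>
    is added for the unit cube.\<close>
  define s where "s = real k + real CARD('n)"
  have s: "s > 0" by (simp add: s_def add_nonneg_pos)
  have "x \<in> gauge_ball D 1 + lattice_of ((1/s) *\<^sub>R M)" for x
  proof -
    \<comment> \<open>\<open>s *\<^sub>R x\<close> is rounded down to \<open>z\<close>, and
      \<open>z\<close> is replaced by a representative \<open>w\<close> of its coset inside the ball
      of radius \<open>k\<close>; the remainder lies in the unit cube.\<close>
    define z where "z = (\<chi> i. \<lfloor>(s *\<^sub>R x) $ i\<rfloor>)"
    obtain w where w: "real_vec w \<in> gauge_ball D (real k)" "\<phi> z = \<phi> w"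
      using diam unfolding diameter_le_iff by force
    then have "z - w \<in> L" by (simp add: L_def eq_iff[of z w])
    then obtain c where c: "real_vec (z - w) = transpose M *v real_vec c"
      using M(2) unfolding lattice_of_eq by blast
    have "s *\<^sub>R x - real_vec z \<in> gauge_ball D (real CARD('n) * 1)"
      by (rule cube_subset_gauge_ball) (auto simp: z_def; linarith)+
    from gauge_ball_add[OF w(1) this]
    have "s *\<^sub>R (x - (1/s) *\<^sub>R real_vec (z - w)) \<in> gauge_ball D (s * 1)"
      using s by (simp add: s_def[symmetric] real_vec_diff algebra_simps)
    then have "x - (1/s) *\<^sub>R real_vec (z - w) \<in> gauge_ball D 1"
      by (simp only: gauge_ball_scaleR[OF s])
    moreover have "(1/s) *\<^sub>R real_vec (z - w) \<in> lattice_of ((1/s) *\<^sub>R M)"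
      unfolding lattice_of_eq c
      by (rule range_eqI[of _ _ c]) (simp add: vec_eq_iff vector_matrix_mult_def sum_distrib_left mult_ac)
    ultimately show ?thesis
      by (metis diff_add_cancel set_plus_intro)
  qed
  \<comment> \<open>As \<open>\<bar>det M\<bar>\<close> is \<open>m\<close>, the scaled lattice has
    efficiency \<open>m\<close> divided by the volume times \<open>s ^ CARD('n)\<close>.\<close>
  moreover have det: "det ((1/s) *\<^sub>R M) = det M / s ^ CARD('n)"
    by (simp add: det_scaleR power_one_over)
  ultimately have "lattice_covering (gauge_ball D 1) ((1/s) *\<^sub>R M)"
    using best M(1) s unfolding is_best_efficiency_def lattice_covering_def generates_lattice_iff by auto
  then have "covering_efficiency (gauge_ball D 1) ((1/s) *\<^sub>R M) \<le> \<epsilon>"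
    and "measure lebesgue (gauge_ball D 1 :: (real^'n) set) > 0"
    using best by (auto simp: is_best_efficiency_def lattice_covering_def)
  then show ?thesis
    using s card by (simp add: s_def[symmetric] covering_efficiency_def det abs_div field_simps)
qed

section \<open>Rounding a covering lattice\<close>

lemma gauge_ball_True_eq_hull: "gauge_ball True 1 = convex hull (insert 0 Basis :: (real^'n) set)"
proof -
  have Basis: "(Basis :: (real^'n) set) = range (\<lambda>i. axis i 1)"
    by (auto simp: Basis_vec_def)
  have "inj (\<lambda>i::'n. axis i (1::real))"
    by (simp add: inj_def axis_eq_axis)
  then have sum: "(\<Sum>b\<in>Basis. x \<bullet> b) = (\<Sum>i\<in>UNIV. x $ i)" for x :: "real^'n"
    unfolding Basis by (simp add: sum.reindex inner_axis)
  have "(\<forall>b\<in>Basis. 0 \<le> x \<bullet> b) \<longleftrightarrow> (\<forall>i. 0 \<le> x $ i)" for x :: "real^'n"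
    by (simp add: Basis inner_axis)
  then show ?thesis
    unfolding std_simplex sum by (auto simp: gauge_ball_def)
qed

lemma lmeasurable_gauge_ball_True: "gauge_ball True 1 \<in> lmeasurable"
  unfolding gauge_ball_True_eq_hull
  by (intro lmeasurable_compact finite_imp_compact_convex_hull) simp

lemma measure_gauge_ball_True:
  "measure lebesgue (gauge_ball True 1 :: (real^'n) set) = 1 / fact CARD('n)"
proof -
  have "convex hull (insert 0 Basis :: (real^'n) set) \<in> sets lborel"
    using finite_imp_compact_convex_hull[of "insert 0 Basis :: (real^'n) set"]
    by (simp add: compact_imp_closed)
  then show ?thesis
    by (simp add: gauge_ball_True_eq_hull content_std_simplex)
qed

text \<open>The coordinate orthants cut the cross polytope into reflected corner simplices
  \<open>F A\<close>, where \<open>A\<close> is the set of coordinates with reversed sign. Two of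
  them meet inside a coordinate hyperplane.\<close>

lemma measure_gauge_ball_False:
  "measure lebesgue (gauge_ball False 1 :: (real^'n) set) = 2 ^ CARD('n) / fact CARD('n)"
proof -
  define s :: "'n set \<Rightarrow> 'n \<Rightarrow> real" where "s A i = (if i \<in> A then -1 else 1)" for A i
  define F :: "'n set \<Rightarrow> (real^'n) set" where
    "F A = (\<lambda>x. \<chi> i. s A i * x $ i) ` gauge_ball True 1" for A
  have s: "s A i * s A i = 1" "\<bar>s A i\<bar> = 1" for A i by (simp_all add: s_def)
  have mem_F: "x \<in> F A \<longleftrightarrow> (\<chi> i. s A i * x $ i) \<in> gauge_ball True 1" for x A
  proof -
    let ?g = "\<lambda>x::real^'n. \<chi> i. s A i * x $ i"
    have "?g (?g y) = y" for y
      by (simp add: vec_eq_iff s flip: mult.assoc)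
    then show ?thesis unfolding F_def by (intro iffI image_eqI[of x ?g "?g x"]) (auto simp: image_iff)
  qed
  have prod_s: "\<bar>prod (s A) UNIV\<bar> = 1" for A
    by (simp add: abs_prod s)
  have F: "F A \<in> lmeasurable" "measure lebesgue (F A) = 1 / fact CARD('n)" for A
    using measurable_stretch[OF lmeasurable_gauge_ball_True, of "s A"]
      measure_stretch[OF lmeasurable_gauge_ball_True, of "s A"]
    by (simp_all only: F_def prod_s measure_gauge_ball_True mult_1)
  have "gauge_ball False 1 = (\<Union>A. F A)"
  proof (intro equalityI subsetI)
    fix x :: "real^'n"
    assume x: "x \<in> gauge_ball False 1"
    have "0 \<le> s {i. x $ i < 0} i * x $ i" for i by (simp add: s_def)
    then have "x \<in> F {i. x $ i < 0}"
      using x unfolding mem_F by (simp add: gauge_ball_def abs_mult s)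
    then show "x \<in> (\<Union>A. F A)" by blast
  next
    fix x assume "x \<in> (\<Union>A. F A)"
    then show "x \<in> gauge_ball False 1"
      by (auto simp: mem_F gauge_ball_def abs_mult s)
  qed
  moreover have "measure lebesgue (\<Union>A. F A) = (\<Sum>A\<in>UNIV. measure lebesgue (F A))"
  proof (rule measure_negligible_finite_Union_image)
    show "pairwise (\<lambda>A B. negligible (F A \<inter> F B)) UNIV"
    proof (rule pairwiseI)
      fix A B :: "'n set"
      assume "A \<noteq> B"
      then obtain i where "(i \<in> A) \<noteq> (i \<in> B)" by blast
      then have opposite: "s A i = - s B i" by (auto simp: s_def)
      have "x $ i = 0" if "x \<in> F A" "x \<in> F B" for x
      proof -
        have "0 \<le> s A i * x $ i" "0 \<le> s B i * x $ i"
          using that by (auto simp: mem_F gauge_ball_def)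
        then show ?thesis using opposite s(2)[of B i] by auto
      qed
      then have "F A \<inter> F B \<subseteq> {x. x $ i = 0}" by blast
      then show "negligible (F A \<inter> F B)"
        by (rule negligible_subset[rotated]) (rule negligible_standard_hyperplane_cart)
    qed
  qed (use F in auto)
  moreover have "card (UNIV :: 'n set set) = 2 ^ CARD('n)"
    by (simp add: card_Pow flip: Pow_UNIV)
  ultimately show ?thesis by (simp add: F)
qed

section \<open>Perturbation of determinants\<close>

lemma det_lipschitz:
  fixes A B :: "real^'n^'n"
  assumes R: "1 \<le> R" and A: "\<And>i j. \<bar>A $ i $ j\<bar> \<le> R" and B: "\<And>i j. \<bar>B $ i $ j\<bar> \<le> R"
    and \<delta>: "\<And>i j. \<bar>A $ i $ j - B $ i $ j\<bar> \<le> \<delta>"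
  shows "\<bar>det A - det B\<bar> \<le> fact CARD('n) * (R ^ CARD('n) * (real CARD('n) * \<delta>))"
proof -
  have prod: "\<bar>(\<Prod>i\<in>UNIV. A $ i $ p i) - (\<Prod>i\<in>UNIV. B $ i $ p i)\<bar> \<le> R ^ CARD('n) * (real CARD('n) * \<delta>)"
    for p :: "'n \<Rightarrow> 'n"
  proof -
    \<comment> \<open>Dividing by \<open>R\<close> brings all factors to absolute value at most 1,
      as \<open>norm_prod_diff\<close> requires. Since \<open>R\<close> is at least 1, this does not
      enlarge the differences of entries.\<close>
    have scale: "(\<Prod>i\<in>UNIV. C $ i $ p i) = R ^ CARD('n) * (\<Prod>i\<in>UNIV. C $ i $ p i / R)"
      for C :: "real^'n^'n"
      using R by (simp add: prod_dividef)
    have "norm ((\<Prod>i\<in>UNIV. A $ i $ p i / R) - (\<Prod>i\<in>UNIV. B $ i $ p i / R))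
        \<le> (\<Sum>i\<in>UNIV. norm (A $ i $ p i / R - B $ i $ p i / R))"
      using A B R by (intro norm_prod_diff) simp_all
    also have "\<dots> \<le> (\<Sum>i\<in>(UNIV :: 'n set). \<delta>)"
    proof (rule sum_mono)
      fix i
      have "norm (A $ i $ p i / R - B $ i $ p i / R) = \<bar>A $ i $ p i - B $ i $ p i\<bar> / R"
        using R by (simp flip: diff_divide_distrib)
      also have "\<dots> \<le> \<delta>"
        using R \<delta>[of i "p i"] mult_left_mono[of 1 R \<delta>] order_trans[OF abs_ge_zero \<delta>[of i "p i"]]
        by (simp add: divide_le_eq)
      finally show "norm (A $ i $ p i / R - B $ i $ p i / R) \<le> \<delta>" .
    qed
    finally show ?thesis
      unfolding scale[of A] scale[of B] right_diff_distrib[symmetric]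
      using R by (simp add: abs_mult)
  qed
  \<comment> \<open>Leibniz formula: the product estimate is summed over all permutations, which
    gives the factorial.\<close>
  have "det A - det B = (\<Sum>p | p permutes (UNIV::'n set).
      of_int (sign p) * ((\<Prod>i\<in>UNIV. A $ i $ p i) - (\<Prod>i\<in>UNIV. B $ i $ p i)))"
    unfolding det_def by (simp add: sum_subtractf right_diff_distrib)
  also have "\<bar>\<dots>\<bar> \<le> (\<Sum>p | p permutes (UNIV::'n set). R ^ CARD('n) * (real CARD('n) * \<delta>))"
    by (rule order_trans[OF sum_abs sum_mono]) (simp add: abs_mult sign_def prod)
  finally show ?thesis
    by (simp add: card_permutations)
qed

text \<open>The entries of \<open>M' / k\<close> are within \<open>1 / k\<close> of those of
  \<open>M\<close>, so the determinants differ by at most \<open>C / k\<close>; multiplying by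
  \<open>k ^ CARD('n)\<close> leaves an error one order lower.\<close>

lemma det_near_multiple:
  fixes M :: "real^'n^'n"
  obtains C where "\<And>k M'. \<lbrakk>0 < k; \<And>i j. \<bar>M' $ i $ j - real k * M $ i $ j\<bar> \<le> 1\<rbrakk>
    \<Longrightarrow> \<bar>det M\<bar> * real k ^ CARD('n) - C * real k ^ (CARD('n) - 1) \<le> \<bar>det M'\<bar>"
proof -
  \<comment> \<open>The extra 1 leaves room for the entries of \<open>M' / k\<close>, which exceed
    those of \<open>M\<close> by at most \<open>1 / k\<close> in absolute value.\<close>
  define R where "R = (\<Sum>i\<in>UNIV. \<Sum>j\<in>UNIV. \<bar>M $ i $ j\<bar>) + 1"
  have entry: "\<bar>M $ i $ j\<bar> \<le> R - 1" for i j
  proof -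
    have "\<bar>M $ i $ j\<bar> \<le> (\<Sum>j\<in>UNIV. \<bar>M $ i $ j\<bar>)"
      by (rule member_le_sum) auto
    also have "\<dots> \<le> (\<Sum>i\<in>UNIV. \<Sum>j\<in>UNIV. \<bar>M $ i $ j\<bar>)"
      by (rule member_le_sum[of i UNIV "\<lambda>i. \<Sum>j\<in>UNIV. \<bar>M $ i $ j\<bar>"]) (auto intro: sum_nonneg)
    finally show ?thesis by (simp add: R_def)
  qed
  have R: "1 \<le> R" by (simp add: R_def sum_nonneg)
  define C where "C = fact CARD('n) * (R ^ CARD('n) * real CARD('n))"
  have "\<bar>det M\<bar> * real k ^ CARD('n) - C * real k ^ (CARD('n) - 1) \<le> \<bar>det M'\<bar>"
    if k: "0 < k" and M': "\<And>i j. \<bar>M' $ i $ j - real k * M $ i $ j\<bar> \<le> 1" for k and M' :: "real^'n^'n"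
  proof -
    define B where "B = (1 / real k) *\<^sub>R M'"
    have diff: "\<bar>M $ i $ j - B $ i $ j\<bar> \<le> 1 / real k" for i j
    proof -
      have "M $ i $ j - B $ i $ j = - (M' $ i $ j - real k * M $ i $ j) / real k"
        using k by (simp add: B_def field_simps)
      then show ?thesis using M'[of i j] k by (simp add: divide_right_mono)
    qed
    have "1 / real k \<le> 1" using k by simp
    then have "\<bar>B $ i $ j\<bar> \<le> R" for i j
      using diff[of i j] entry[of i j] by linarith
    moreover have "\<bar>M $ i $ j\<bar> \<le> R" for i j using entry[of i j] by linarith
    ultimately have "\<bar>det M - det B\<bar> \<le> C * (1 / real k)"
      using det_lipschitz[OF R _ _ diff] unfolding C_def by (simp add: mult_ac)
    then have "\<bar>det M\<bar> - C / real k \<le> \<bar>det B\<bar>" by simp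
    then have "(\<bar>det M\<bar> - C / real k) * real k ^ CARD('n) \<le> \<bar>det B\<bar> * real k ^ CARD('n)"
      by (rule mult_right_mono) simp
    also have "\<bar>det B\<bar> * real k ^ CARD('n) = \<bar>det M'\<bar>"
      using k by (simp add: B_def det_scaleR abs_mult power_one_over)
    also have "(\<bar>det M\<bar> - C / real k) * real k ^ CARD('n)
        = \<bar>det M\<bar> * real k ^ CARD('n) - C * real k ^ (CARD('n) - 1)"
      using k power_Suc[of "real k" "CARD('n) - 1"] by (simp add: left_diff_distrib)
    finally show ?thesis .
  qed
  then show ?thesis using that by blast
qed

section \<open>Coverings by rounded lattices\<close>

lemma covering_near_multiple:
  fixes M :: "real^'n^'n"
  assumes M: "det M \<noteq> 0" and cover: "gauge_ball D 1 + lattice_of M = UNIV"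
  obtains c where "\<And>k A. \<lbrakk>0 < k; det A \<noteq> 0; \<And>i j. \<bar>real_mat A $ i $ j - real k * M $ i $ j\<bar> \<le> 1\<rbrakk>
    \<Longrightarrow> \<forall>z. \<exists>w. real_vec w \<in> gauge_ball D (real (k + c)) \<and> real_vec (z - w) \<in> lattice_of (real_mat A)"
proof -
  \<comment> \<open>\<open>g\<close> recovers coordinates with respect to the rows of
    \<open>M\<close>. It is bounded, and the body lies in the Euclidean unit ball, so
    \<open>K\<close> bounds the coordinates of all its points.\<close>
  obtain g :: "real^'n \<Rightarrow> real^'n" where g: "linear g" "\<And>x. g (transpose M *v x) = x"
    using linear_injective_left_inverse[OF matrix_vector_mul_linear inj_transpose_mult[OF M]]
    by (auto simp: fun_eq_iff)
  obtain K where K: "K > 0" "\<And>x. norm (g x) \<le> K * norm x"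
    using linear_bounded_pos[OF g(1)] by blast
  have coeff: "\<bar>a $ i\<bar> \<le> K" if "transpose M *v a \<in> gauge_ball D 1" for a i
  proof -
    have "norm (transpose M *v a) \<le> 1"
      using norm_le_l1_cart[of "transpose M *v a"] that by (auto simp: gauge_ball_def)
    then have "K * norm (transpose M *v a) \<le> K * 1" using K(1) by (intro mult_left_mono) auto
    then show ?thesis
      using K(2)[of "transpose M *v a"] component_le_norm_cart[of a i] unfolding g(2) by linarith
  qed
  \<comment> \<open>Rows whose entries move by at most 1, combined with coefficients at most
    \<open>K\<close>, shift each coordinate by at most \<open>CARD('n) * K\<close>.\<close>
  define t where "t = nat \<lceil>real CARD('n) * K\<rceil>"
  have t: "real CARD('n) * K \<le> real t" by (simp add: t_def real_nat_ceiling_ge)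
  \<comment> \<open>Sum of the side lengths of the cube \<open>[0, 2 t]\<close>, which contains the
    shifted error.\<close>
  define c where "c = CARD('n) * (2 * t)"
  have "\<exists>w. real_vec w \<in> gauge_ball D (real (k + c)) \<and> real_vec (z - w) \<in> lattice_of (real_mat A)"
    if k: "0 < k" and A: "det A \<noteq> 0"
      and near: "\<And>i j. \<bar>real_mat A $ i $ j - real k * M $ i $ j\<bar> \<le> 1" for k A z
  proof -
    \<comment> \<open>The rounding error lies in \<open>[-t, t]\<close>; shifting by \<open>v\<close> makes it nonnegative, as the corner
        simplex requires.\<close>
    define v :: "int^'n" where "v = (\<chi> i. int t)"
    have "det (real_mat A) \<noteq> 0" using A by (simp add: det_real_mat)
    then obtain a where a: "real_vec (z - v) = transpose (real_mat A) *v a"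
      using surj_transpose_mult by blast
    \<comment> \<open>The point with the same coordinates \<open>a\<close> in the rows of
      \<open>M\<close> is reduced by the given covering; subtracting the same integer coordinates
      \<open>n\<close> then reduces modulo the rounded lattice.\<close>
    obtain s n where s: "s \<in> gauge_ball D 1" "transpose M *v a = s + transpose M *v real_vec n"
      using cover unfolding lattice_of_eq by (metis (no_types, lifting) UNIV_I rangeE set_plus_elim)
    define b where "b = a - real_vec n"
    have b: "transpose M *v b = s"
      using s(2) by (simp add: b_def matrix_vector_mult_diff_distrib del: transpose_matrix_vector)
    define w where "w = z - (\<Sum>i\<in>UNIV. n $ i *s A $ i)"
    have w: "real_vec (z - w) \<in> lattice_of (real_mat A)"
      unfolding lattice_of_eq transpose_real_mat_mult w_def by auto
    \<comment> \<open>The error of using \<open>A\<close> in place of \<open>k M\<close> for the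
      coordinates \<open>b\<close>, plus the shift.\<close>
    define e where "e = transpose (real_mat A) *v b - real k *\<^sub>R s + real_vec v"
    have w_eq: "real_vec w = real k *\<^sub>R s + e"
    proof -
      have "real_vec w = real_vec v + real_vec (z - v) - transpose (real_mat A) *v real_vec n"
        by (simp only: w_def real_vec_diff transpose_real_mat_mult) simp
      also have "\<dots> = real_vec v + transpose (real_mat A) *v b"
        unfolding a b_def matrix_vector_mult_diff_distrib by simp
      finally show ?thesis by (simp add: e_def)
    qed
    have e: "\<bar>e $ j - real t\<bar> \<le> real t" for j
    proof -
      have "e $ j - real t = (\<Sum>i\<in>UNIV. b $ i * (real_mat A $ i $ j - real k * M $ i $ j))"
        by (simp add: e_def v_def b[symmetric] matrix_vector_mult_def vector_matrix_mult_def transpose_def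
            sum_distrib_left sum_subtractf algebra_simps)
      also have "\<bar>\<dots>\<bar> \<le> (\<Sum>i\<in>(UNIV::'n set). K)"
      proof (rule order_trans[OF sum_abs sum_mono])
        fix i
        have "\<bar>b $ i\<bar> * \<bar>real_mat A $ i $ j - real k * M $ i $ j\<bar> \<le> K * 1"
          using coeff[of b i] s(1) b near by (intro mult_mono) auto
        then show "\<bar>b $ i * (real_mat A $ i $ j - real k * M $ i $ j)\<bar> \<le> K"
          by (simp add: abs_mult)
      qed
      finally show ?thesis using t by simp
    qed
    have "e \<in> gauge_ball D (real CARD('n) * (2 * real t))"
    proof (rule cube_subset_gauge_ball)
      show "0 \<le> e $ j" "e $ j \<le> 2 * real t" for j
        using e[of j] by linarith+
    qed
    moreover have "real k *\<^sub>R s \<in> gauge_ball D (real k * 1)"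
      using s(1) k by (subst gauge_ball_scaleR) auto
    ultimately have "real_vec w \<in> gauge_ball D (real (k + c))"
      unfolding w_eq using gauge_ball_add by (fastforce simp: c_def)
    with w show ?thesis by blast
  qed
  then show ?thesis using that by blast
qed

text \<open>The group is the quotient of the integer vectors by the lattice, generated by the cosets
  of the unit vectors, and \<open>index_eq_abs_det\<close> gives its order. Its elements are sets of
  vectors; \<open>order_in_sizes\<close> passes to groups on \<open>nat\<close>.\<close>

lemma int_lattice_in_sizes:
  fixes A :: "int^'n^'n"
  assumes A: "det A \<noteq> 0"
    and cover: "\<forall>z. \<exists>w. real_vec w \<in> gauge_ball D (real k) \<and> real_vec (z - w) \<in> lattice_of (real_mat A)"
  shows "\<exists>m\<in>sizes D CARD('n) k. real m = \<bar>det (real_mat A)\<bar>"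
proof -
  interpret Z: comm_group int_vec_group by (rule comm_group_int_vec_group)
  define L where "L = {z. real_vec z \<in> lattice_of (real_mat A)}"
  have L: "subgroup L (int_vec_group :: (int^'n) monoid)"
  proof (rule Z.subgroupI)
    have "real_vec 0 \<in> lattice_of (real_mat A)"
      unfolding lattice_of_eq by (rule range_eqI[of _ _ 0]) (simp add: vec_eq_iff vector_matrix_mult_def)
    then show "L \<noteq> {}" unfolding L_def by blast
    have minus: "real_vec (- c) = - real_vec c" for c :: "int^'n" by (simp add: vec_eq_iff)
    show "inv\<^bsub>int_vec_group\<^esub> x \<in> L" if "x \<in> L" for x
    proof -
      obtain c where "real_vec x = transpose (real_mat A) *v real_vec c"
        using \<open>x \<in> L\<close> unfolding L_def lattice_of_eq by blast
      then have "real_vec (- x) = transpose (real_mat A) *v real_vec (- c)"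
        by (simp only: minus linear_neg[OF matrix_vector_mul_linear])
      then show ?thesis unfolding L_def lattice_of_eq by simp
    qed
    show "x \<otimes>\<^bsub>int_vec_group\<^esub> y \<in> L" if xy: "x \<in> L" "y \<in> L" for x y
    proof -
      obtain c d where "real_vec x = transpose (real_mat A) *v real_vec c"
          "real_vec y = transpose (real_mat A) *v real_vec d"
        using xy unfolding L_def lattice_of_eq by blast
      then have "real_vec (x + y) = transpose (real_mat A) *v real_vec (c + d)"
        by (simp only: real_vec_add matrix_vector_right_distrib)
      then show ?thesis unfolding L_def lattice_of_eq by auto
    qed
  qed simp
  define Q where "Q = int_vec_group Mod L"
  define \<phi> where "\<phi> z = L #>\<^bsub>int_vec_group\<^esub> z" for z
  obtain xs :: "'n list" where xs: "set xs = UNIV" "distinct xs"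
    using finite_distinct_list[of "UNIV :: 'n set"] by auto
  define gs where "gs = map (\<lambda>i. \<phi> (axis i 1)) xs"
  interpret Q: comm_group Q
    unfolding Q_def by (rule Z.abelian_FactGroup[OF L])
  interpret int_vec_hom Q \<phi> gs
  proof unfold_locales
    show "\<phi> \<in> hom int_vec_group Q"
      unfolding Q_def \<phi>_def using normal.r_coset_hom_Mod[OF Z.subgroup_imp_normal[OF L]] .
  qed (simp add: gs_def xs)
  have range: "range \<phi> = carrier Q"
    by (auto simp: Q_def FactGroup_def RCOSETS_def \<phi>_def)
  have eq: "\<phi> x = \<phi> y \<longleftrightarrow> real_vec (x - y) \<in> lattice_of (real_mat A)" for x y
  proof -
    have "\<phi> (x - y) = \<one>\<^bsub>Q\<^esub> \<longleftrightarrow> x - y \<in> L"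
      using Z.coset_join1[OF _ _ L, of "x - y"] Z.coset_join2[OF _ L, of "x - y"]
      by (auto simp: Q_def FactGroup_def \<phi>_def)
    then show ?thesis by (simp add: eq_iff[of x y] L_def)
  qed
  have diam: "graph_diameter (carrier Q) (cayley D Q gs) \<le> enat k"
    unfolding diameter_le_iff
  proof
    fix y assume "y \<in> carrier Q"
    then obtain z where "y = \<phi> z" using range by blast
    then show "\<exists>z. real_vec z \<in> gauge_ball D (real k) \<and> y = \<phi> z"
      using cover eq by metis
  qed
  have "abelian_generated_by CARD('n) Q gs"
    unfolding abelian_generated_by_def
    using generated[OF diam] xs Q.comm_group_axioms distinct_card[of xs]
    by (auto simp: gs_def)
  then have "order Q \<in> sizes D CARD('n) k"
    using diam by (rule order_in_sizes)
  moreover have "real (card (range \<phi>)) = \<bar>det (real_mat A)\<bar>"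
  proof (rule index_eq_abs_det[OF _ _ eq])
    show "lattice_of (real_mat A) \<subseteq> range real_vec"
      unfolding lattice_of_eq transpose_real_mat_mult by blast
  qed (use A diam range finite_of_diameter in \<open>auto simp: det_real_mat\<close>)
  ultimately show ?thesis
    by (auto simp: order_def range)
qed

text \<open>Rounding down the entries of \<open>k M\<close> gives an integer matrix to which the
  determinant and covering estimates both apply, with constants independent of
  \<open>k\<close>.\<close>

lemma size_lower_bound:
  fixes M :: "real^'n^'n"
  assumes M: "det M \<noteq> 0" and cover: "gauge_ball D 1 + lattice_of M = UNIV"
  obtains c C where "\<And>k. 0 < k \<Longrightarrow> \<exists>m\<in>sizes D CARD('n) (k + c).
    \<bar>det M\<bar> * real k ^ CARD('n) - C * real k ^ (CARD('n) - 1) \<le> real m"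
proof -
  obtain C where C: "\<And>k M'. \<lbrakk>0 < k; \<And>i j. \<bar>M' $ i $ j - real k * M $ i $ j\<bar> \<le> 1\<rbrakk>
    \<Longrightarrow> \<bar>det M\<bar> * real k ^ CARD('n) - C * real k ^ (CARD('n) - 1) \<le> \<bar>det M'\<bar>"
    using det_near_multiple by blast
  obtain c where c: "\<And>k A. \<lbrakk>0 < k; det A \<noteq> 0; \<And>i j. \<bar>real_mat A $ i $ j - real k * M $ i $ j\<bar> \<le> 1\<rbrakk>
    \<Longrightarrow> \<forall>z. \<exists>w. real_vec w \<in> gauge_ball D (real (k + c)) \<and> real_vec (z - w) \<in> lattice_of (real_mat A)"
    using covering_near_multiple[OF M cover] by blast
  have "\<exists>m\<in>sizes D CARD('n) (k + c).
    \<bar>det M\<bar> * real k ^ CARD('n) - C * real k ^ (CARD('n) - 1) \<le> real m" if k: "0 < k" for k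
  proof -
    define A :: "int^'n^'n" where "A = (\<chi> i j. \<lfloor>real k * M $ i $ j\<rfloor>)"
    have near: "\<bar>real_mat A $ i $ j - real k * M $ i $ j\<bar> \<le> 1" for i j
      by (simp add: A_def) linarith
    have det: "\<bar>det M\<bar> * real k ^ CARD('n) - C * real k ^ (CARD('n) - 1) \<le> \<bar>det (real_mat A)\<bar>"
      using C k near by blast
    show ?thesis
    \<comment> \<open>The rounded matrix may be singular. The determinant estimate then makes the
      left side at most 0, so any attainable size will do.\<close>
    proof (cases "det A = 0")
      case True
      then show ?thesis
        using det sizes_nonempty[of D "CARD('n)" "k + c"]
        by (metis abs_zero det_real_mat of_int_0 of_nat_0_le_iff order_trans all_not_in_conv)
    next
      case False
      then obtain m where "m \<in> sizes D CARD('n) (k + c)" "real m = \<bar>det (real_mat A)\<bar>"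
        using int_lattice_in_sizes[OF False c[OF k False near]] by blast
      then show ?thesis using det by (intro bexI[of _ m]) simp_all
    qed
  qed
  then show ?thesis using that by blast
qed

section \<open>Asymptotics\<close>

lemma shifted_power_bigo:
  assumes "0 < n"
  shows "(\<lambda>k::nat. (real k + a) ^ n - real k ^ n) \<in> O(\<lambda>k. real k ^ (n - 1))"
proof (rule bigoI)
  show "\<forall>\<^sub>F k in at_top. norm ((real k + a) ^ n - real k ^ n)
      \<le> (\<bar>a\<bar> * real n * 2 ^ (n - 1)) * norm (real k ^ (n - 1))"
    \<comment> \<open>Once \<open>k\<close> is at least \<open>\<bar>a\<bar>\<close>, both
      \<open>k\<close> and \<open>\<bar>k + a\<bar>\<close> are at most \<open>2 k\<close>, which
      bounds each of the \<open>n\<close> terms in the factored difference of powers.\<close>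
    using eventually_ge_at_top[of "nat \<lceil>\<bar>a\<bar>\<rceil>"]
  proof eventually_elim
    case (elim k)
    then have a: "\<bar>a\<bar> \<le> real k" by linarith
    have "norm (\<Sum>i<n. real k ^ (n - Suc i) * (real k + a) ^ i) \<le> (\<Sum>i<n. (2 * real k) ^ (n - 1))"
    proof (rule sum_norm_le)
      fix i assume "i \<in> {..<n}"
      then have n: "n - 1 = (n - Suc i) + i" by simp
      have "norm (real k ^ (n - Suc i) * (real k + a) ^ i) = real k ^ (n - Suc i) * \<bar>real k + a\<bar> ^ i"
        by (simp add: abs_mult power_abs)
      also have "\<dots> \<le> (2 * real k) ^ (n - Suc i) * (2 * real k) ^ i"
        using a by (intro mult_mono power_mono) auto
      finally show "norm (real k ^ (n - Suc i) * (real k + a) ^ i) \<le> (2 * real k) ^ (n - 1)"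
        unfolding n power_add .
    qed
    then have "\<bar>a\<bar> * norm (\<Sum>i<n. real k ^ (n - Suc i) * (real k + a) ^ i)
        \<le> \<bar>a\<bar> * (real n * (2 * real k) ^ (n - 1))"
      by (intro mult_left_mono) auto
    moreover have "(real k + a) ^ n - real k ^ n = a * (\<Sum>i<n. real k ^ (n - Suc i) * (real k + a) ^ i)"
      by (subst power_diff_sumr2) simp
    ultimately show ?case
      by (simp add: abs_mult power_mult_distrib mult_ac)
  qed
qed

text \<open>The best efficiency is attained, so an optimal lattice gives a lower bound with the same
  leading coefficient as the upper bound; the shifts of \<open>k\<close> by constants only affect
  lower order.\<close>

lemma largest_size_asymptotics:
  assumes best: "is_best_efficiency (gauge_ball D 1 :: (real^'n) set) \<epsilon>"
  shows "(\<lambda>k. real (Max (sizes D CARD('n) k))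
      - \<epsilon> * measure lebesgue (gauge_ball D 1 :: (real^'n) set) * real k ^ CARD('n))
    \<in> O(\<lambda>k. real k ^ (CARD('n) - 1))"
proof -
  let ?n = "CARD('n)"
  define V where "V = \<epsilon> * measure lebesgue (gauge_ball D 1 :: (real^'n) set)"
  define f where "f k = real (Max (sizes D ?n k))" for k
  obtain M :: "real^'n^'n" where M: "lattice_covering (gauge_ball D 1) M"
      "covering_efficiency (gauge_ball D 1) M = \<epsilon>"
    using best by (auto simp: is_best_efficiency_def)
  have V: "V = \<bar>det M\<bar>" and det: "det M \<noteq> 0" and cover: "gauge_ball D 1 + lattice_of M = UNIV"
    using M by (auto simp: V_def covering_efficiency_def lattice_covering_def generates_lattice_iff)
  obtain c C where low: "\<And>k. 0 < k \<Longrightarrow> \<exists>m\<in>sizes D ?n (k + c).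
      V * real k ^ ?n - C * real k ^ (?n - 1) \<le> real m"
    using size_lower_bound[OF det cover] unfolding V by blast
  have upper: "f k \<le> V * (real k + real ?n) ^ ?n" for k
    using size_upper_bound[OF best Max_in[OF finite_sizes sizes_nonempty]]
    by (simp add: f_def V_def)
  have lower: "V * (real k + - real c) ^ ?n - \<bar>C\<bar> * real k ^ (?n - 1) \<le> f k" if "c < k" for k
  proof -
    \<comment> \<open>The lower bound built from scale \<open>j\<close> concerns diameter
      \<open>j + c\<close>. Since \<open>C\<close> may be negative, \<open>\<bar>C\<bar>\<close> is
      used to pass from powers of \<open>j\<close> to powers of \<open>k\<close>.\<close>
    define j where "j = k - c"
    have j: "0 < j" "k = j + c" "real j = real k + - real c" using that by (auto simp: j_def)
    obtain m where m: "m \<in> sizes D ?n k" "V * real j ^ ?n - C * real j ^ (?n - 1) \<le> real m"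
      using low[OF j(1)] j(2) by blast
    have "C * real j ^ (?n - 1) \<le> \<bar>C\<bar> * real k ^ (?n - 1)"
      using j(2) by (intro mult_mono power_mono) auto
    moreover have "real m \<le> f k"
      using Max_ge[OF finite_sizes m(1)] by (simp add: f_def)
    ultimately show ?thesis using m(2) by (simp add: j(3))
  qed
  let ?u = "\<lambda>k. (real k + real ?n) ^ ?n - real k ^ ?n"
  let ?l = "\<lambda>k. (real k + - real c) ^ ?n - real k ^ ?n"
  \<comment> \<open>Majorizes the deviation on both sides, whichever bound is the relevant
    one.\<close>
  let ?b = "\<lambda>k::nat. V * \<bar>?u k\<bar> + V * \<bar>?l k\<bar> + \<bar>C\<bar> * real k ^ (?n - 1)"
  have "?b \<in> O(\<lambda>k. real k ^ (?n - 1))"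
    using shifted_power_bigo[of ?n "real ?n"] shifted_power_bigo[of ?n "- real c"]
    by (intro sum_in_bigo) auto
  moreover have "(\<lambda>k. f k - V * real k ^ ?n) \<in> O(?b)"
  proof (rule bigoI[of _ 1])
    show "\<forall>\<^sub>F k in at_top. norm (f k - V * real k ^ ?n) \<le> 1 * norm (?b k)"
      using eventually_gt_at_top[of c]
    proof eventually_elim
      case (elim k)
      have V0: "0 \<le> V" by (simp add: V)
      have "V * ?u k \<le> V * \<bar>?u k\<bar>" "V * - ?l k \<le> V * \<bar>?l k\<bar>"
        using V0 by (intro mult_left_mono; simp)+
      moreover have "0 \<le> V * \<bar>?u k\<bar>" "0 \<le> V * \<bar>?l k\<bar>" "0 \<le> \<bar>C\<bar> * real k ^ (?n - 1)"
        using V0 by simp_all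
      moreover have "V * ?u k = V * (real k + real ?n) ^ ?n - V * real k ^ ?n"
          "V * - ?l k = V * real k ^ ?n - V * (real k + - real c) ^ ?n"
        by (simp_all add: right_diff_distrib)
      ultimately have "\<bar>f k - V * real k ^ ?n\<bar> \<le> ?b k"
        using upper[of k] lower[OF elim] by (intro abs_leI) linarith+
      then show ?case by (simp add: order_trans[OF _ abs_ge_self])
    qed
  qed
  ultimately show ?thesis
    unfolding f_def V_def by (rule landau_o.big_trans[rotated])
qed

text \<open>Both parts are cases of \<open>largest_size_asymptotics\<close>; the volumes of the two
  bodies supply the factors \<open>2 ^ CARD('n) / fact CARD('n)\<close> and
  \<open>1 / fact CARD('n)\<close>.\<close>

theorem corollary10:
  shows "(\<forall>\<epsilon>. is_best_efficiency (cross_polytope :: (real^'n) set) \<epsilon> \<longrightarrow>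
            (\<lambda>k. real (largest_undirected CARD('n) k)
                   - 2 ^ CARD('n) * \<epsilon> / fact CARD('n) * real k ^ CARD('n))
              \<in> O[at_top](\<lambda>k. real k ^ (CARD('n) - 1)))
       \<and> (\<forall>\<epsilon>'. is_best_efficiency (corner_simplex :: (real^'n) set) \<epsilon>' \<longrightarrow>
            (\<lambda>k. real (largest_directed CARD('n) k)
                   - \<epsilon>' / fact CARD('n) * real k ^ CARD('n))
              \<in> O[at_top](\<lambda>k. real k ^ (CARD('n) - 1)))"
  using largest_size_asymptotics[of False, where 'n = 'n]
    largest_size_asymptotics[of True, where 'n = 'n]
  unfolding cross_polytope_eq corner_simplex_eq measure_gauge_ball_False measure_gauge_ball_True
  by (simp add: largest_undirected_def largest_directed_def sizes_def mult.commute)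

end
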